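(* Consider the system on $SO(3)$ $$\frac{d}{dt}R_t=R_t(\omega(t))_\times,\qquad Y_k=\begin{pmatrix} Y_k^0 \\ Y_k^1 \end{pmatrix}=\begin{pmatrix} R_{t_k}^Td_k^0+V_k^0 \\ R_{t_k}^Td_k^1+V_k^1 \end{pmatrix},\quad k=1,2,\dots,$$ where $\omega(t)\in\mathbb R^3$ is known, $t_1\le t_2\le\cdots$, $d_k^0,d_k^1\in\mathbb R^3$ are known vectors, and $V_k^0,V_k^1$ are mutually independent centered Gaussian vectors with covariances $(\sigma_k^0)^2I_3$, $(\sigma_k^1)^2I_3$, with $\sigma_k^0,\sigma_k^1>0$. Let $H_k^i=(d_k^i)_\times$, $i=0,1$, and assume $\frac{{H_1^0}^TH_1^0}{(\sigma_1^0)^2}+\frac{{H_1^1}^TH_1^1}{(\sigma_1^1)^2}$ is invertible. Then for every $n\ge1$ the covariance matrix $P_n$ of the (linearized) error returned by the Invariant Extended Kalman Filter (IEKF) after processing $Y_1,\dots,Y_n$ is $$P_n=\left(\sum_{k=1}^n\frac{{H_k^0}^TH_k^0}{(\sigma_k^0)^2}+\sum_{k=1}^n\frac{{H_k^1}^TH_k^1}{(\sigma_k^1)^2}\right)^{-1},$$ and thus the IEKF returns the intrinsic Cramér–Rao bound for this filtering problem, neglecting the curvature terms; that is, $P_n=J_n^{-1}$, where $J_n$ is the intrinsic Fisher information matrix of $(Y_1,\dots,Y_n)$ with respect to $R_{t_n}$.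
   Context: For $a\in\mathbb R^3$, $(a)_\times\in\mathbb R^{3\times3}$ is the skew-symmetric matrix with $(a)_\times u=a\times u$. $\exp:\mathbb R^3\to SO(3)$ is $\exp(\xi)=\mathrm{expm}[(\xi)_\times]$, where $\mathrm{expm}$ is the matrix exponential, with local inverse $\log$. Intrinsic Fisher information. $J_n$ is the symmetric $3\times3$ matrix with $\xi^TJ_n\xi=-\mathbf E\left(\left.\frac{d^2}{ds^2}\right|_{s=0}\ln p(Y_1,\dots,Y_n\mid\exp(s\xi)R_{t_n})\right)$ for all $\xi\in\mathbb R^3$, where $p(\cdot\mid R)$ is the density of $(Y_1,\dots,Y_n)$ when the state at time $t_n$ is $R$ (the deterministic dynamics then determine all $R_{t_k}$, $k\le n$). The intrinsic Cramér–Rao bound neglecting curvature terms is $J_n^{-1}$. The IEKF. Between measurements the estimate satisfies $\frac{d}{dt}\hat R_t=\hat R_t(\omega(t))_\times$; at $t_n$ it is updated by $$\hat R_{t_n}^+=\exp\left(K_n\begin{pmatrix} \hat R_{t_n}Y_n^0-d_n^0 \\ \hat R_{t_n}Y_n^1-d_n^1 \end{pmatrix}\right)\hat R_{t_n}.$$ With the right-invariant error $\xi_t=\log(\hat R_tR_t^T)$, the matrix returned by the filter is the covariance $P_t=\mathbf E(\xi_t\xi_t^T)$ of the linearized error, defined as follows. Propagation: $\frac{d}{dt}\xi_t=0$, so the covariance before the update at $t_n$ is $P_{t_n}=P_{n-1}$. Update ($n\ge2$): the first-order error update is $\xi_{t_n}^+=(I_3-K_nH_n)\xi_{t_n}+K_n\begin{pmatrix}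 V_n^0 \\ V_n^1 \end{pmatrix}$ with $H_n=\begin{pmatrix} H_n^0 \\ H_n^1 \end{pmatrix}\in\mathbb R^{6\times3}$, with the noise independent of $\xi_{t_n}$, and $K_n\in\mathbb R^{3\times6}$ is the Kalman gain $K_n=P_{t_n}H_n^T(H_nP_{t_n}H_n^T+N_n)^{-1}$, $N_n=\begin{pmatrix} (\sigma_n^0)^2I_3 & 0 \\ 0 & (\sigma_n^1)^2I_3 \end{pmatrix}$. $P_n$ is the resulting covariance of $\xi_{t_n}^+$. Initialization ($n=1$): there is no prior on $R_{t_1}$, and $\hat R_{t_1}$ is the maximum likelihood estimate, minimizing $\|\hat RY_1^0-d_1^0\|^2/(\sigma_1^0)^2+\|\hat RY_1^1-d_1^1\|^2/(\sigma_1^1)^2$ over $\hat R\in SO(3)$. $P_1$ is the covariance of its first-order error, i.e. of the minimizer $\xi_{t_1}$ of $\|\xi\times d_1^0+V_1^0\|^2/(\sigma_1^0)^2+\|\xi\times d_1^1+V_1^1\|^2/(\sigma_1^1)^2$ over $\xi\in\mathbb R^3$. The first measurement is used in this initialization only. *)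

theory Defs
  imports "HOL-Probability.Probability"
begin

definition skew :: "real^3 \<Rightarrow> real^3^3" where
  "skew a = matrix (\<lambda>u. cross3 a u)"

definition SO3 :: "(real^3^3) set" where
  "SO3 = {Q. rotation_matrix Q}"

(* The product "*" on vectors is componentwise, so neither "^" nor the library's
   "exp" gives matrix powers or the matrix exponential. *)
definition expm :: "real^'n^'n \<Rightarrow> real^'n^'n" where
  "expm A = (\<Sum>k. (1 / fact k) *\<^sub>R (((\<lambda>B. A ** B) ^^ k) (mat 1)))"

definition exp_SO3 :: "real^3 \<Rightarrow> real^3^3" where
  "exp_SO3 \<xi> = expm (skew \<xi>)"

(* Vertical concatenation: of vectors for 'a = real, of matrices for 'a a row type. *)
definition stack :: "'a^'m \<Rightarrow> 'a^'n \<Rightarrow> 'a^('m + 'n)" where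
  "stack u v = (\<chi> i. case i of Inl j \<Rightarrow> u $ j | Inr j \<Rightarrow> v $ j)"

definition block_diag :: "real^'m^'m \<Rightarrow> real^'n^'n \<Rightarrow> real^('m + 'n)^('m + 'n)" where
  "block_diag A B = stack (\<chi> i. stack (A $ i) 0) (\<chi> i. stack 0 (B $ i))"

definition gaussian_density :: "real^'n \<Rightarrow> real^'n^'n \<Rightarrow> real^'n \<Rightarrow> real" where
  "gaussian_density \<mu> S x =
     exp (- ((x - \<mu>) \<bullet> (matrix_inv S *v (x - \<mu>))) / 2) / sqrt ((2 * pi) ^ CARD('n) * det S)"

definition gaussian_vector ::
  "'w measure \<Rightarrow> ('w \<Rightarrow> real^'n) \<Rightarrow> real^'n \<Rightarrow> real^'n^'n \<Rightarrow> bool" where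
  "gaussian_vector M X \<mu> S \<longleftrightarrow> distributed M lborel X (\<lambda>x. ennreal (gaussian_density \<mu> S x))"

(* E (X X^T) *)
definition second_moment :: "'w measure \<Rightarrow> ('w \<Rightarrow> real^'n) \<Rightarrow> real^'n^'n" where
  "second_moment M X = (\<chi> i j. \<integral>w. X w $ i * X w $ j \<partial>M)"

definition has_second_derivative :: "(real \<Rightarrow> real) \<Rightarrow> real \<Rightarrow> real \<Rightarrow> bool" where
  "has_second_derivative f D x \<longleftrightarrow>
     (\<exists>f'. (\<forall>\<^sub>F s in nhds x. (f has_real_derivative f' s) (at s)) \<and>
           (f' has_real_derivative D) (at x))"

definition attitude_trajectory :: "(real \<Rightarrow> real^3) \<Rightarrow> real set \<Rightarrow> (real \<Rightarrow> real^3^3) \<Rightarrow> bool" where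
  "attitude_trajectory om T X \<longleftrightarrow>
     (\<forall>s\<in>T. X s \<in> SO3 \<and> (X has_vector_derivative X s ** skew (om s)) (at s within T))"

(* Measurement number k \<ge> 1, channel i \<in> {0, 1}, along the state trajectory X. *)
definition measurement ::
  "(nat \<Rightarrow> real) \<Rightarrow> (nat \<Rightarrow> nat \<Rightarrow> real^3) \<Rightarrow> (nat \<Rightarrow> nat \<Rightarrow> 'w \<Rightarrow> real^3) \<Rightarrow> (real \<Rightarrow> real^3^3)
    \<Rightarrow> nat \<Rightarrow> nat \<Rightarrow> 'w \<Rightarrow> real^3" where
  "measurement t d V X k i w = transpose (X (t k)) *v d k i + V k i w"

(* (Y_1, ..., Y_n) as a point of the product of the 2n spaces R^3. *)
definition observations ::
  "(nat \<Rightarrow> real) \<Rightarrow> (nat \<Rightarrow> nat \<Rightarrow> real^3) \<Rightarrow> (nat \<Rightarrow> nat \<Rightarrow> 'w \<Rightarrow> real^3) \<Rightarrow> (real \<Rightarrow> real^3^3)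
    \<Rightarrow> nat \<Rightarrow> 'w \<Rightarrow> (nat \<times> nat \<Rightarrow> real^3)" where
  "observations t d V X n w = (\<lambda>(k, i) \<in> {1..n} \<times> {0, 1}. measurement t d V X k i w)"

(* p Q is the density of (Y_1, ..., Y_n) when the state at time t n is Q. Densities are only
   determined almost everywhere; continuity singles out the version whose pointwise values
   are meant. *)
definition is_likelihood ::
  "'w measure \<Rightarrow> (real \<Rightarrow> real^3) \<Rightarrow> (nat \<Rightarrow> real) \<Rightarrow> (nat \<Rightarrow> nat \<Rightarrow> real^3)
    \<Rightarrow> (nat \<Rightarrow> nat \<Rightarrow> 'w \<Rightarrow> real^3) \<Rightarrow> nat \<Rightarrow> (real^3^3 \<Rightarrow> (nat \<times> nat \<Rightarrow> real^3) \<Rightarrow> real) \<Rightarrow> bool" where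
  "is_likelihood M om t d V n p \<longleftrightarrow>
     (\<forall>X. attitude_trajectory om {t 1..} X \<longrightarrow>
        distributed M (PiM ({1..n} \<times> {0, 1}) (\<lambda>_. lborel)) (observations t d V X n)
          (\<lambda>y. ennreal (p (X (t n)) y)) \<and>
        (\<forall>y \<in> PiE ({1..n} \<times> {0, 1}) (\<lambda>_. UNIV). p (X (t n)) y \<ge> 0) \<and>
        continuous_on (PiE ({1..n} \<times> {0, 1}) (\<lambda>_. UNIV)) (p (X (t n))))"

(* J is the intrinsic Fisher information matrix of (Y_1, ..., Y_n) with respect to the state at
   time t n, at the true trajectory R. *)
definition is_fisher_information ::
  "'w measure \<Rightarrow> (real \<Rightarrow> real^3) \<Rightarrow> (nat \<Rightarrow> real) \<Rightarrow> (nat \<Rightarrow> nat \<Rightarrow> real^3)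
    \<Rightarrow> (nat \<Rightarrow> nat \<Rightarrow> 'w \<Rightarrow> real^3) \<Rightarrow> (real \<Rightarrow> real^3^3) \<Rightarrow> nat \<Rightarrow> real^3^3 \<Rightarrow> bool" where
  "is_fisher_information M om t d V R n J \<longleftrightarrow>
     transpose J = J \<and>
     (\<exists>p. is_likelihood M om t d V n p \<and>
        (\<forall>\<xi>. \<exists>D. (\<forall>w\<in>space M. has_second_derivative
                     (\<lambda>s. ln (p (exp_SO3 (s *\<^sub>R \<xi>) ** R (t n)) (observations t d V R n w))) (D w) 0) \<and>
                  integrable M D \<and>
                  \<xi> \<bullet> (J *v \<xi>) = - (\<integral>w. D w \<partial>M)))"

definition kalman_gain :: "real^'n^'n \<Rightarrow> real^'n^'m \<Rightarrow> real^'m^'m \<Rightarrow> real^'m^'n" where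
  "kalman_gain P H N = P ** transpose H ** matrix_inv (H ** P ** transpose H + N)"

(* Rhat n s and xi n s (t n \<le> s \<le> t (n + 1)) are the estimate and the linearized right-invariant
   error between the n-th and the (n+1)-th measurement: their values at s = t n are those after
   processing Y_1, ..., Y_n, and their values at s = t (n + 1) those just before the (n+1)-th
   update. This also covers t n = t (n + 1). *)

definition iekf_estimate ::
  "'w measure \<Rightarrow> (real \<Rightarrow> real^3) \<Rightarrow> (nat \<Rightarrow> real) \<Rightarrow> (nat \<Rightarrow> nat \<Rightarrow> real^3) \<Rightarrow> (nat \<Rightarrow> nat \<Rightarrow> real)
    \<Rightarrow> (nat \<Rightarrow> nat \<Rightarrow> 'w \<Rightarrow> real^3) \<Rightarrow> (nat \<Rightarrow> real^(3+3)^3) \<Rightarrow> (nat \<Rightarrow> real \<Rightarrow> 'w \<Rightarrow> real^3^3) \<Rightarrow> bool"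
  where
  "iekf_estimate M om t d \<sigma> Y K Rhat \<longleftrightarrow>
     (\<forall>w\<in>space M.
        is_arg_min
          (\<lambda>Q. (norm (Q *v Y 1 0 w - d 1 0))\<^sup>2 / (\<sigma> 1 0)\<^sup>2 + (norm (Q *v Y 1 1 w - d 1 1))\<^sup>2 / (\<sigma> 1 1)\<^sup>2)
          (\<lambda>Q. Q \<in> SO3) (Rhat 1 (t 1) w) \<and>
        (\<forall>n\<ge>1. attitude_trajectory om {t n..t (n + 1)} (\<lambda>s. Rhat n s w)) \<and>
        (\<forall>n\<ge>2. let Q = Rhat (n - 1) (t n) w in
           Rhat n (t n) w =
             exp_SO3 (K n *v stack (Q *v Y n 0 w - d n 0) (Q *v Y n 1 w - d n 1)) ** Q))"

definition iekf_linearized_error ::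
  "'w measure \<Rightarrow> (nat \<Rightarrow> real) \<Rightarrow> (nat \<Rightarrow> nat \<Rightarrow> real^3) \<Rightarrow> (nat \<Rightarrow> nat \<Rightarrow> real)
    \<Rightarrow> (nat \<Rightarrow> nat \<Rightarrow> 'w \<Rightarrow> real^3) \<Rightarrow> (nat \<Rightarrow> real^(3+3)^3) \<Rightarrow> (nat \<Rightarrow> real \<Rightarrow> 'w \<Rightarrow> real^3) \<Rightarrow> bool"
  where
  "iekf_linearized_error M t d \<sigma> V K xi \<longleftrightarrow>
     (\<forall>w\<in>space M.
        is_arg_min
          (\<lambda>x. (norm (cross3 x (d 1 0) + V 1 0 w))\<^sup>2 / (\<sigma> 1 0)\<^sup>2
             + (norm (cross3 x (d 1 1) + V 1 1 w))\<^sup>2 / (\<sigma> 1 1)\<^sup>2)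
          (\<lambda>_. True) (xi 1 (t 1) w) \<and>
        (\<forall>n\<ge>1. \<forall>s\<in>{t n..t (n + 1)}.
           ((\<lambda>s. xi n s w) has_vector_derivative 0) (at s within {t n..t (n + 1)})) \<and>
        (\<forall>n\<ge>2. xi n (t n) w =
           (mat 1 - K n ** stack (skew (d n 0)) (skew (d n 1))) *v xi (n - 1) (t n) w
             + K n *v stack (V n 0 w) (V n 1 w)))"

(* P n is the covariance matrix returned after processing Y_1, ..., Y_n. *)
definition iekf ::
  "'w measure \<Rightarrow> (real \<Rightarrow> real^3) \<Rightarrow> (nat \<Rightarrow> real) \<Rightarrow> (nat \<Rightarrow> nat \<Rightarrow> real^3) \<Rightarrow> (nat \<Rightarrow> nat \<Rightarrow> real)
    \<Rightarrow> (nat \<Rightarrow> nat \<Rightarrow> 'w \<Rightarrow> real^3) \<Rightarrow> (real \<Rightarrow> real^3^3) \<Rightarrow> (nat \<Rightarrow> real \<Rightarrow> 'w \<Rightarrow> real^3^3)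
    \<Rightarrow> (nat \<Rightarrow> real \<Rightarrow> 'w \<Rightarrow> real^3) \<Rightarrow> (nat \<Rightarrow> real^(3+3)^3) \<Rightarrow> (nat \<Rightarrow> real^3^3) \<Rightarrow> bool"
  where
  "iekf M om t d \<sigma> V R Rhat xi K P \<longleftrightarrow>
     iekf_estimate M om t d \<sigma> (measurement t d V R) K Rhat \<and>
     iekf_linearized_error M t d \<sigma> V K xi \<and>
     (\<forall>n\<ge>2. K n = kalman_gain (second_moment M (xi (n - 1) (t n)))
                    (stack (skew (d n 0)) (skew (d n 1)))
                    (block_diag ((\<sigma> n 0)\<^sup>2 *\<^sub>R mat 1) ((\<sigma> n 1)\<^sup>2 *\<^sub>R mat 1))) \<and>
     (\<forall>n\<ge>1. P n = second_moment M (xi n (t n)))"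

end

theory Submission
  imports Defs
begin

text \<open>
  Write \<open>C\<^sub>n\<close> for the sum of the \<open>H\<^sup>T H / \<sigma>\<^sup>2\<close> over the first \<open>n\<close> measurements and both
  channels. In information form the Kalman update reads \<open>C\<^sub>n K\<^sub>n = H\<^sub>n\<^sup>T N\<^sub>n\<^sup>-\<^sup>1\<close> and
  \<open>C\<^sub>n (1 - K\<^sub>n H\<^sub>n) = C\<^sub>n\<^sub>-\<^sub>1\<close>, and the normal equations of the initial least squares problem have
  the same shape; hence \<open>C\<^sub>n \<xi>\<^sub>n\<close> is, for every outcome, the accumulated score \<open>\<Sum> H\<^sup>T V / \<sigma>\<^sup>2\<close>,
  whose second moment is \<open>C\<^sub>n\<close>. On the statistical side, left multiplication permutes the
  trajectories transitively, so the state at time \<open>t\<^sub>n\<close> determines the Gaussian likelihood. Along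
  \<open>exp (s \<xi>) R\<close> its logarithm is affine in the rotation \<open>exp (s \<xi>)\<close>, with second derivative
  \<open>\<Sum> (\<xi> \<times> (\<xi> \<times> (R V + d))) \<bullet> d / \<sigma>\<^sup>2\<close> at \<open>s = 0\<close> and expectation \<open>- \<Sum> |\<xi> \<times> d|\<^sup>2 / \<sigma>\<^sup>2\<close>.
\<close>

subsection \<open>Matrix algebra\<close>

text \<open>The interpretation that follows turns this into distributive laws, scaling and sum
  rules, and the Leibniz rule for curves of matrices.\<close>

lemma bounded_bilinear_matrix_matrix_mult:
  "bounded_bilinear ((**) :: real^'n^'m \<Rightarrow> real^'k^'n \<Rightarrow> real^'k^'m)"
  unfolding bilinear_conv_bounded_bilinear[symmetric] bilinear_def
  by (auto intro!: linearI simp: matrix_matrix_mult_def vec_eq_iff sum.distrib sum_distrib_left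
      algebra_simps)

interpretation matrix_mult: bounded_bilinear
  "(**) :: real^'n^'m \<Rightarrow> real^'k^'n \<Rightarrow> real^'k^'m"
  by (rule bounded_bilinear_matrix_matrix_mult)

lemma transpose_add: "transpose (A + B) = transpose A + transpose (B :: 'a::plus^'n^'m)"
  by (simp add: transpose_def vec_eq_iff)

lemma bounded_linear_transpose: "bounded_linear (transpose :: real^'n^'m \<Rightarrow> real^'m^'n)"
  unfolding linear_conv_bounded_linear[symmetric]
  by (intro linearI) (simp_all add: transpose_add transpose_scalar)

text \<open>As simp rules these would trade products with a transpose for \<open>v*\<close>; all
  adjoints are kept in the form \<open>transpose A *v x\<close>.\<close>

declare transpose_matrix_vector [simp del] vector_transpose_matrix [simp del]

lemma inner_transpose_vector_mult:
  "x \<bullet> (transpose A *v y) = (A *v x) \<bullet> y" for A :: "real^'n^'m"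
  by (metis dot_lmul_matrix vector_transpose_matrix)

text \<open>Polarization: a symmetric matrix with vanishing quadratic form is zero, as evaluating at
  \<open>x + y\<close> kills the bilinear form. The Fisher information is specified only through
  symmetry and its quadratic form, so this is what pins it down.\<close>

lemma symmetric_matrix_eqI:
  fixes A B :: "real^'n^'n"
  assumes "transpose A = A" "transpose B = B" "\<And>x. x \<bullet> (A *v x) = x \<bullet> (B *v x)"
  shows "A = B"
proof -
  define C where "C = A - B"
  have sym: "(C *v y) \<bullet> x = (C *v x) \<bullet> y" for x y
  proof -
    have "transpose C = C"
      using assms by (simp add: C_def transpose_def vec_eq_iff)
    then show ?thesis
      using inner_transpose_vector_mult[of x C y] by (simp add: inner_commute)
  qed
  have zero: "x \<bullet> (C *v x) = 0" for x
    by (simp add: C_def matrix_vector_mult_diff_rdistrib inner_diff_right assms)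
  have "(C *v x) \<bullet> y = 0" for x y
    using zero[of "x + y"] zero[of x] zero[of y] sym[of x y]
    by (simp add: matrix_vector_right_distrib inner_add inner_commute)
  then have "C *v x = 0" for x
    using inner_eq_zero_iff by blast
  then have "C = 0"
    by (simp add: matrix_eq)
  then show ?thesis
    by (simp add: C_def)
qed

lemma matrix_inv_eqI:
  fixes A :: "real^'n^'n"
  assumes "A ** B = mat 1"
  shows "invertible A" "matrix_inv A = B"
proof -
  have "B ** A = mat 1"
    using assms matrix_left_right_inverse by blast
  then show inv: "invertible A"
    using assms invertible_def by blast
  have "A ** matrix_inv A = mat 1 \<and> matrix_inv A ** A = mat 1"
    unfolding matrix_inv_def by (rule someI_ex) (use inv in \<open>simp add: invertible_def\<close>)
  then have "(matrix_inv A ** A) ** B = B"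
    by simp
  then show "matrix_inv A = B"
    unfolding matrix_mul_assoc[symmetric] assms by simp
qed

lemma matrix_inv_right: "invertible A \<Longrightarrow> A ** matrix_inv A = mat 1"
  and matrix_inv_left: "invertible A \<Longrightarrow> matrix_inv A ** A = mat 1" for A :: "real^'n^'n"
  using matrix_inv_eqI(2) unfolding invertible_def by metis+

text \<open>A nonzero kernel vector would make the quadratic form vanish, and a square matrix with
  trivial kernel is invertible.\<close>

lemma positive_definite_invertible:
  fixes A :: "real^'n^'n"
  assumes "\<And>x. x \<noteq> 0 \<Longrightarrow> x \<bullet> (A *v x) > 0"
  shows "invertible A"
proof -
  have "x = 0" if "A *v x = 0" for x
    using assms[of x] that by (cases "x = 0") auto
  then show ?thesis
    by (simp add: invertible_left_inverse matrix_left_invertible_ker)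
qed

subsection \<open>Rodrigues' formula\<close>

lemma skew_vector_mult: "skew a *v u = cross3 a u"
proof -
  have "linear (cross3 a)"
    by (intro linearI) (simp_all add: cross_add_right cross_mult_right)
  then show ?thesis
    by (simp add: skew_def matrix_works)
qed

lemma skew_scaleR: "skew (c *\<^sub>R a) = c *\<^sub>R skew a"
  by (simp add: matrix_eq skew_vector_mult cross_mult_left flip: scaleR_matrix_vector_assoc)

lemma transpose_skew: "transpose (skew a) = - skew a"
  by (simp add: skew_def matrix_def transpose_def vec_eq_iff forall_3 cross3_simps axis_def)

text \<open>Lagrange's formula, applied to \<open>a\<close> and the vector \<open>cross3 a u\<close>
  orthogonal to it. This relation collapses the exponential series to a combination of the identity,
  \<open>skew a\<close> and its square.\<close>

lemma skew_cubed: "skew a ** (skew a ** skew a) = (- (norm a)\<^sup>2) *\<^sub>R skew a"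
proof -
  have "cross3 a (cross3 a (cross3 a u)) = - (norm a)\<^sup>2 *\<^sub>R cross3 a u" for u
    using Lagrange[of a a "cross3 a u"] by (simp add: dot_cross_self power2_norm_eq_inner)
  then show ?thesis
    unfolding matrix_eq matrix_vector_mul_assoc[symmetric] scaleR_matrix_vector_assoc[symmetric]
      skew_vector_mult by simp
qed

text \<open>The cubic relation makes odd powers multiples of \<open>S\<close> and positive even
  powers multiples of \<open>S ** S\<close>, so the series splits into those of sine and cosine. The
  scalar \<open>s\<close> is kept separate in order to differentiate along the line later.\<close>

lemma expm_sums_of_cubed:
  fixes S :: "real^'n^'n"
  assumes cubed: "S ** (S ** S) = (- \<theta>\<^sup>2) *\<^sub>R S" and "\<theta> \<noteq> 0"
  shows "expm (s *\<^sub>R S) =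
           mat 1 + (sin (s * \<theta>) / \<theta>) *\<^sub>R S + ((1 - cos (s * \<theta>)) / \<theta>\<^sup>2) *\<^sub>R (S ** S)"
proof -
  define pow where "pow k = ((\<lambda>B. s *\<^sub>R S ** B) ^^ k) (mat 1)" for k
  have pow_Suc: "pow (Suc k) = s *\<^sub>R (S ** pow k)" for k
    by (simp add: pow_def matrix_mult.scaleR_left)
  have pow_0: "pow 0 = mat 1"
    by (simp add: pow_def)
  have odd: "pow (Suc (2 * j)) = (s * (- (s * \<theta>)\<^sup>2) ^ j) *\<^sub>R S" for j
  proof (induction j)
    case (Suc j)
    have "pow (Suc (2 * Suc j)) = s *\<^sub>R (S ** (s *\<^sub>R (S ** pow (Suc (2 * j)))))"
      by (simp add: pow_Suc)
    also have "\<dots> = (s * (s * (s * (- (s * \<theta>)\<^sup>2) ^ j))) *\<^sub>R (S ** (S ** S))"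
      by (simp add: Suc matrix_mult.scaleR_right)
    also have "\<dots> = (s * (- (s * \<theta>)\<^sup>2) ^ Suc j) *\<^sub>R S"
      unfolding cubed by (simp add: power_mult_distrib power2_eq_square)
    finally show ?case .
  qed (simp add: pow_Suc pow_0)
  have even: "pow (2 * Suc j) = (s * (s * (- (s * \<theta>)\<^sup>2) ^ j)) *\<^sub>R (S ** S)" for j
    using odd[of j] by (simp add: pow_Suc[of "Suc (2 * j)"] matrix_mult.scaleR_right)
  \<comment> \<open>The zeroth power is the identity, but the cosine series contributes a constant
    term in \<open>S ** S\<close> at \<open>k = 0\<close>; the bracket supplies the identity and
    cancels that term.\<close>
  have expand: "(1 / fact k) *\<^sub>R pow k =
      (if k = 0 then mat 1 + (1 / \<theta>\<^sup>2) *\<^sub>R (S ** S) else 0)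
      + (1 / \<theta> * (sin_coeff k * (s * \<theta>) ^ k)) *\<^sub>R S
      - (1 / \<theta>\<^sup>2 * (cos_coeff k * (s * \<theta>) ^ k)) *\<^sub>R (S ** S)" (is "_ = ?g k") for k
  proof (cases "even k")
    case True
    show ?thesis
    proof (cases k)
      case 0
      then show ?thesis by (simp add: pow_0)
    next
      case (Suc m)
      with True obtain j where k: "k = 2 * Suc j"
        by (metis dvd_mult_div_cancel mult_0_right not0_implies_Suc old.nat.distinct(2))
      have "(- (s * \<theta>)\<^sup>2) ^ j = (- 1) ^ j * (s * \<theta>) ^ (2 * j)"
        by (metis mult_minus1 power_mult power_mult_distrib)
      moreover have "1 / \<theta>\<^sup>2 * (s * \<theta>) ^ k = s * (s * (s * \<theta>) ^ (2 * j))"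
        using \<open>\<theta> \<noteq> 0\<close> by (simp add: k power2_eq_square)
      moreover have coeff: "cos_coeff k = - ((- 1) ^ j / fact k)" "sin_coeff k = 0"
        using True by (simp_all add: cos_coeff_def sin_coeff_def k)
      moreover have "1 / \<theta>\<^sup>2 * (cos_coeff k * (s * \<theta>) ^ k) =
          cos_coeff k * (1 / \<theta>\<^sup>2 * (s * \<theta>) ^ k)"
        by simp
      ultimately have cos: "1 / \<theta>\<^sup>2 * (cos_coeff k * (s * \<theta>) ^ k) =
          - (1 / fact k * (s * (s * (- (s * \<theta>)\<^sup>2) ^ j)))"
        by simp
      have "?g k = - ((1 / \<theta>\<^sup>2 * (cos_coeff k * (s * \<theta>) ^ k)) *\<^sub>R (S ** S))"
        using coeff(2) Suc by simp
      also have "\<dots> = (1 / fact k) *\<^sub>R pow k"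
        unfolding cos even[of j, folded k] by simp
      finally show ?thesis by simp
    qed
  next
    case False
    then obtain j where k: "k = Suc (2 * j)"
      by (metis oddE Suc_eq_plus1)
    have "(- (s * \<theta>)\<^sup>2) ^ j = (- 1) ^ j * (s * \<theta>) ^ (2 * j)"
      by (metis mult_minus1 power_mult power_mult_distrib)
    moreover have "1 / \<theta> * (s * \<theta>) ^ k = s * (s * \<theta>) ^ (2 * j)"
      using \<open>\<theta> \<noteq> 0\<close> by (simp add: k)
    moreover have coeff: "sin_coeff k = (- 1) ^ j / fact k" "cos_coeff k = 0"
      using False by (simp_all add: sin_coeff_def cos_coeff_def k)
    moreover have "1 / \<theta> * (sin_coeff k * (s * \<theta>) ^ k) = sin_coeff k * (1 / \<theta> * (s * \<theta>) ^ k)"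
      by simp
    ultimately have sin: "1 / \<theta> * (sin_coeff k * (s * \<theta>) ^ k) =
        1 / fact k * (s * (- (s * \<theta>)\<^sup>2) ^ j)"
      by simp
    have "?g k = (1 / \<theta> * (sin_coeff k * (s * \<theta>) ^ k)) *\<^sub>R S"
      using coeff(2) k by simp
    also have "\<dots> = (1 / fact k) *\<^sub>R pow k"
      unfolding sin odd[of j, folded k] by simp
    finally show ?thesis by simp
  qed
  have "(\<lambda>k. ?g k) sums (mat 1 + (1 / \<theta>\<^sup>2) *\<^sub>R (S ** S) + (1 / \<theta> * sin (s * \<theta>)) *\<^sub>R S
        - (1 / \<theta>\<^sup>2 * cos (s * \<theta>)) *\<^sub>R (S ** S))"
    using sin_converges[of "s * \<theta>"] cos_converges[of "s * \<theta>"]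
    by (intro sums_diff sums_add sums_scaleR_left sums_mult) (auto intro: sums_single)
  then have "expm (s *\<^sub>R S) = mat 1 + (1 / \<theta>\<^sup>2) *\<^sub>R (S ** S) + (1 / \<theta> * sin (s * \<theta>)) *\<^sub>R S
        - (1 / \<theta>\<^sup>2 * cos (s * \<theta>)) *\<^sub>R (S ** S)"
    unfolding expm_def pow_def[symmetric] expand by (rule sums_unique[symmetric])
  then show ?thesis
    by (simp add: diff_divide_distrib scaleR_left_diff_distrib)
qed

text \<open>Treated apart because Rodrigues' formula divides by the norm of the rotation
  vector.\<close>

lemma exp_SO3_zero: "exp_SO3 0 = mat 1"
proof -
  have "skew 0 = 0"
    using skew_scaleR[of 0 0] by simp
  then have "(1 / fact k) *\<^sub>R ((\<lambda>B. skew 0 ** B) ^^ k) (mat 1) = (if k = 0 then mat 1 else 0 :: real^3^3)"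
    for k
    by (cases k) (simp_all add: matrix_mult.zero_left)
  then have "(\<lambda>k. (1 / fact k) *\<^sub>R ((\<lambda>B. skew 0 ** B) ^^ k) (mat 1)) sums (mat 1 :: real^3^3)"
    using sums_single[of 0 "\<lambda>_. mat 1 :: real^3^3"] by presburger
  then show ?thesis
    by (simp add: exp_SO3_def expm_def sums_unique[symmetric])
qed

lemma rodrigues:
  assumes "\<xi> \<noteq> 0"
  shows "exp_SO3 (s *\<^sub>R \<xi>) = mat 1 + (sin (s * norm \<xi>) / norm \<xi>) *\<^sub>R skew \<xi>
           + ((1 - cos (s * norm \<xi>)) / (norm \<xi>)\<^sup>2) *\<^sub>R (skew \<xi> ** skew \<xi>)"
  unfolding exp_SO3_def skew_scaleR
  using assms by (intro expm_sums_of_cubed skew_cubed) simp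

text \<open>The eigenvalues of \<open>skew \<xi>\<close> are 0 and plus or minus i times
  \<open>norm \<xi>\<close>, so the determinant is the squared modulus of the factor at one
  imaginary eigenvalue. The proof expands the entries instead.\<close>

lemma det_quadratic_skew:
  "det (mat 1 + a *\<^sub>R skew \<xi> + b *\<^sub>R (skew \<xi> ** skew \<xi>)) =
     (1 - b * (norm \<xi>)\<^sup>2)\<^sup>2 + a\<^sup>2 * (norm \<xi>)\<^sup>2"
proof -
  have S: "skew \<xi> $ 1 $ 1 = 0" "skew \<xi> $ 1 $ 2 = - \<xi> $ 3" "skew \<xi> $ 1 $ 3 = \<xi> $ 2"
    "skew \<xi> $ 2 $ 1 = \<xi> $ 3" "skew \<xi> $ 2 $ 2 = 0" "skew \<xi> $ 2 $ 3 = - \<xi> $ 1"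
    "skew \<xi> $ 3 $ 1 = - \<xi> $ 2" "skew \<xi> $ 3 $ 2 = \<xi> $ 1" "skew \<xi> $ 3 $ 3 = 0"
    by (simp_all add: skew_def matrix_def cross_components axis_def)
  have n: "(norm \<xi>)\<^sup>2 = \<xi> $ 1 * \<xi> $ 1 + \<xi> $ 2 * \<xi> $ 2 + \<xi> $ 3 * \<xi> $ 3"
    by (simp add: power2_norm_eq_inner inner_vec_def sum_3)
  have SS: "(skew \<xi> ** skew \<xi>) $ i $ j = (\<Sum>k\<in>UNIV. skew \<xi> $ i $ k * skew \<xi> $ k $ j)" for i j
    by (simp add: matrix_matrix_mult_def)
  have I: "(mat 1 :: real^3^3) $ i $ j = (if i = j then 1 else 0)" for i j
    by (simp add: mat_def)
  show ?thesis
    unfolding n det_3 vector_add_component vector_scaleR_component SS I sum_3 S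
    by simp algebra
qed

lemma exp_SO3_in_SO3: "exp_SO3 \<xi> \<in> SO3"
proof (cases "\<xi> = 0")
  case True
  then show ?thesis
    by (simp add: exp_SO3_zero SO3_def rotation_matrix_def orthogonal_matrix_id)
next
  case False
  define S where "S = skew \<xi>"
  define \<theta> where "\<theta> = norm \<xi>"
  define a b where "a = sin \<theta> / \<theta>" and "b = (1 - cos \<theta>) / \<theta>\<^sup>2"
  have \<theta>: "\<theta> \<noteq> 0"
    using False by (simp add: \<theta>_def)
  have E: "exp_SO3 \<xi> = mat 1 + a *\<^sub>R S + b *\<^sub>R (S ** S)"
    using rodrigues[OF False, of 1] by (simp add: a_def b_def \<theta>_def S_def)
  have T: "transpose (exp_SO3 \<xi>) = mat 1 - a *\<^sub>R S + b *\<^sub>R (S ** S)"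
    unfolding E
    by (simp add: transpose_add transpose_scalar transpose_skew S_def matrix_transpose_mul
        matrix_mult.minus_left matrix_mult.minus_right)
  have cubed: "S ** (S ** S) = (- \<theta>\<^sup>2) *\<^sub>R S"
    using skew_cubed[of \<xi>] by (simp add: S_def \<theta>_def)
  \<comment> \<open>This is the coefficient of \<open>S ** S\<close> left in
    \<open>transpose E ** E\<close>, where E is the exponential: the transpose flips the sign of the
    \<open>S\<close> term, and the fourth power of \<open>S\<close> reduces to a multiple of its
    square. Scaled by the squared angle it becomes the Pythagorean identity.\<close>
  have coeff: "2 * b - a * a - b * b * \<theta>\<^sup>2 = 0"
  proof -
    have "\<theta>\<^sup>2 * (2 * b - a * a - b * b * \<theta>\<^sup>2) = 2 * (b * \<theta>\<^sup>2) - (a * \<theta>)\<^sup>2 - (b * \<theta>\<^sup>2)\<^sup>2"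
      by (simp add: algebra_simps power2_eq_square)
    also have "\<dots> = 2 * (1 - cos \<theta>) - (sin \<theta>)\<^sup>2 - (1 - cos \<theta>)\<^sup>2"
      using \<theta> by (simp add: a_def b_def)
    also have "\<dots> = 0"
      using sin_cos_squared_add[of \<theta>] by (simp add: power2_eq_square algebra_simps)
    finally show ?thesis using \<theta> by simp
  qed
  have "transpose (exp_SO3 \<xi>) ** exp_SO3 \<xi> = mat 1 + (2 * b - a * a - b * b * \<theta>\<^sup>2) *\<^sub>R (S ** S)"
    unfolding T unfolding E
    by (simp add: matrix_mult.add_left matrix_mult.add_right matrix_mult.diff_left cubed
        matrix_mult.scaleR_left matrix_mult.scaleR_right matrix_mult.minus_right algebra_simps
        scaleR_2[symmetric]
        flip: matrix_mul_assoc)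
  then have orth: "transpose (exp_SO3 \<xi>) ** exp_SO3 \<xi> = mat 1"
    by (simp add: coeff)
  have "det (exp_SO3 \<xi>) = (1 - b * \<theta>\<^sup>2)\<^sup>2 + a\<^sup>2 * \<theta>\<^sup>2"
    unfolding E S_def \<theta>_def by (rule det_quadratic_skew)
  also have "\<dots> = (cos \<theta>)\<^sup>2 + (sin \<theta>)\<^sup>2"
    using \<theta> by (simp add: a_def b_def power_divide)
  finally show ?thesis
    using orth by (simp add: SO3_def rotation_matrix_def orthogonal_matrix)
qed

section \<open>Second derivatives at a point, and those of the rotation exponential\<close>

lemma has_second_derivative_linear_combination:
  assumes "has_second_derivative f D x" "has_second_derivative g E x"
  shows "has_second_derivative (\<lambda>s. c + a * f s + b * g s) (a * D + b * E) x"
proof -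
  from assms obtain f' g' where
    f': "\<forall>\<^sub>F s in nhds x. (f has_real_derivative f' s) (at s)" "(f' has_real_derivative D) (at x)" and
    g': "\<forall>\<^sub>F s in nhds x. (g has_real_derivative g' s) (at s)" "(g' has_real_derivative E) (at x)"
    unfolding has_second_derivative_def by blast
  have "\<forall>\<^sub>F s in nhds x. ((\<lambda>s. c + a * f s + b * g s) has_real_derivative a * f' s + b * g' s) (at s)"
    using f'(1) g'(1) by eventually_elim (auto intro!: derivative_eq_intros)
  moreover have "((\<lambda>s. a * f' s + b * g' s) has_real_derivative a * D + b * E) (at x)"
    using f'(2) g'(2) by (auto intro!: derivative_eq_intros)
  ultimately show ?thesis
    unfolding has_second_derivative_def by (intro exI[of _ "\<lambda>s. a * f' s + b * g' s"]) simp
qed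

text \<open>Any two witnesses for the first derivative agree near the point, hence have the same
  derivative there. It identifies an arbitrary second derivative in the Fisher information with the
  computed one.\<close>

lemma has_second_derivative_unique:
  assumes "has_second_derivative f D x" "has_second_derivative f E x"
  shows "D = E"
proof -
  from assms obtain f' g' where
    f': "\<forall>\<^sub>F s in nhds x. (f has_real_derivative f' s) (at s)" "(f' has_real_derivative D) (at x)" and
    g': "\<forall>\<^sub>F s in nhds x. (f has_real_derivative g' s) (at s)" "(g' has_real_derivative E) (at x)"
    unfolding has_second_derivative_def by blast
  have "\<forall>\<^sub>F s in nhds x. f' s = g' s"
    using f'(1) g'(1) by eventually_elim (rule DERIV_unique)
  then have "(g' has_real_derivative D) (at x)"
    using f'(2) DERIV_cong_ev[OF refl _ refl] by blast
  then show ?thesis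
    using g'(2) DERIV_unique by blast
qed

text \<open>Hides the trigonometric coefficients: a function affine in the rotation needs only their
  second derivatives at 0, and the zero vector is covered by the same format.\<close>

lemma exp_SO3_second_order:
  obtains f g where "\<And>s. exp_SO3 (s *\<^sub>R \<xi>) = mat 1 + f s *\<^sub>R skew \<xi> + g s *\<^sub>R (skew \<xi> ** skew \<xi>)"
    and "has_second_derivative f 0 0" and "has_second_derivative g 1 0"
proof (cases "\<xi> = 0")
  case True
  have skew0: "skew 0 = 0"
    using skew_scaleR[of 0 0] by simp
  have "has_second_derivative (\<lambda>s. s) 0 0"
    unfolding has_second_derivative_def
    by (intro exI[of _ "\<lambda>_. 1"]) (auto intro!: derivative_eq_intros always_eventually)
  moreover have "has_second_derivative (\<lambda>s. s\<^sup>2 / 2) 1 0"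
    unfolding has_second_derivative_def
    by (intro exI[of _ "\<lambda>s. s"]) (auto intro!: derivative_eq_intros always_eventually)
  ultimately show ?thesis
    \<comment> \<open>Both matrix terms vanish here, so the coefficients are free; these are the
      limits of the Rodrigues coefficients as the norm tends to 0.\<close>
    using that[of "\<lambda>s. s" "\<lambda>s. s\<^sup>2 / 2"]
    by (simp add: True exp_SO3_zero skew0 matrix_mult.zero_left)
next
  case False
  then have "has_second_derivative (\<lambda>s. sin (s * norm \<xi>) / norm \<xi>) 0 0"
    unfolding has_second_derivative_def
    by (intro exI[of _ "\<lambda>s. cos (s * norm \<xi>)"])
       (auto intro!: derivative_eq_intros always_eventually)
  moreover have "has_second_derivative (\<lambda>s. (1 - cos (s * norm \<xi>)) / (norm \<xi>)\<^sup>2) 1 0"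
    unfolding has_second_derivative_def
    using False
    by (intro exI[of _ "\<lambda>s. sin (s * norm \<xi>) / norm \<xi>"])
       (auto intro!: derivative_eq_intros always_eventually simp: power2_eq_square)
  ultimately show ?thesis
    using that[OF rodrigues[OF False]] by blast
qed

subsection \<open>Trajectories\<close>

lemma SO3_mult: "A \<in> SO3 \<Longrightarrow> B \<in> SO3 \<Longrightarrow> A ** B \<in> SO3"
  by (simp add: SO3_def rotation_matrix_def orthogonal_matrix_mul det_mul)

lemma SO3_transpose: "A \<in> SO3 \<Longrightarrow> transpose A \<in> SO3"
  by (simp add: SO3_def rotation_matrix_def)

lemma SO3_orthogonal:
  assumes "A \<in> SO3"
  shows "A ** transpose A = mat 1" "transpose A ** A = mat 1"
  using assms by (simp_all add: SO3_def rotation_matrix_def orthogonal_matrix_def)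

text \<open>The vector field acts by right multiplication, so left translates of solutions are
  solutions. Hence every rotation is the state at a given time of some trajectory.\<close>

lemma attitude_trajectory_left_mult:
  assumes "Q \<in> SO3" "attitude_trajectory om T X"
  shows "attitude_trajectory om T (\<lambda>s. Q ** X s)"
  using assms unfolding attitude_trajectory_def
  by (auto simp: SO3_mult simp flip: matrix_mul_assoc
      intro!: bounded_linear.has_vector_derivative[OF matrix_mult.bounded_linear_right])

text \<open>\<open>X ** transpose R\<close> has derivative zero, because the two terms of the
  product rule cancel by skew symmetry; it is therefore constant on the convex set. So one state of
  \<open>X\<close> together with the reference trajectory \<open>R\<close> determines all states of
  \<open>X\<close>.\<close>

lemma attitude_trajectory_transition:
  assumes "convex T" "attitude_trajectory om T X" "attitude_trajectory om T R" "a \<in> T" "s \<in> T"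
  shows "X s = X a ** transpose (R a) ** R s"
proof -
  have X: "X u \<in> SO3" "(X has_vector_derivative X u ** skew (om u)) (at u within T)"
    and R: "R u \<in> SO3" "(R has_vector_derivative R u ** skew (om u)) (at u within T)"
    if "u \<in> T" for u
    using assms(2,3) that unfolding attitude_trajectory_def by auto
  have "((\<lambda>u. X u ** transpose (R u)) has_vector_derivative 0) (at u within T)" if "u \<in> T" for u
  proof -
    have "((\<lambda>u. X u ** transpose (R u)) has_vector_derivative
        X u ** transpose (R u ** skew (om u)) + X u ** skew (om u) ** transpose (R u)) (at u within T)"
      using X(2)[OF that] R(2)[OF that]
      by (intro matrix_mult.has_vector_derivative
          bounded_linear.has_vector_derivative[OF bounded_linear_transpose])
    also have "X u ** transpose (R u ** skew (om u)) + X u ** skew (om u) ** transpose (R u) = 0"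
      by (simp add: matrix_transpose_mul transpose_skew matrix_mult.minus_left
          matrix_mult.minus_right flip: matrix_mul_assoc)
    finally show ?thesis .
  qed
  then obtain c where "\<And>u. u \<in> T \<Longrightarrow> X u ** transpose (R u) = c"
    using has_vector_derivative_zero_constant[OF assms(1), of "\<lambda>u. X u ** transpose (R u)"] by blast
  then have "X s ** transpose (R s) = X a ** transpose (R a)"
    by (simp add: assms)
  moreover have "X s ** transpose (R s) ** R s = X s"
    by (simp add: SO3_orthogonal(2)[OF R(1)[OF assms(5)]] flip: matrix_mul_assoc)
  ultimately show ?thesis
    by simp
qed

subsection \<open>Product integrals over Euclidean space\<close>

text \<open>Lebesgue measure is the image of the product measure over \<open>Basis\<close> under
  summing coordinates times basis vectors; pulled back along that map, the integrand is a product of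
  functions of single coordinates.\<close>

lemma
  fixes h :: "'a::euclidean_space \<Rightarrow> real \<Rightarrow> real"
  assumes h: "\<And>b. b \<in> Basis \<Longrightarrow> integrable lborel (h b)"
  shows integrable_lborel_prod: "integrable lborel (\<lambda>x. \<Prod>b\<in>Basis. h b (x \<bullet> b))"
    and integral_lborel_prod:
      "(\<integral>x. (\<Prod>b\<in>Basis. h b (x \<bullet> b)) \<partial>lborel) = (\<Prod>b\<in>Basis. integral\<^sup>L lborel (h b))"
proof -
  interpret product_sigma_finite "\<lambda>_::'a. lborel :: real measure" ..
  have h_meas [measurable]: "h b \<in> borel_measurable borel" if "b \<in> Basis" for b
    using h[OF that] by simp
  let ?F = "\<lambda>x. \<Prod>b\<in>Basis. h b (x \<bullet> b)"
  let ?T = "\<lambda>f. \<Sum>b\<in>Basis. f b *\<^sub>R b"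
  have F [measurable]: "?F \<in> borel_measurable borel"
    by measurable
  have T: "?F (?T f) = (\<Prod>b\<in>Basis. h b (f b))" for f
    by simp
  have "integrable lborel ?F \<longleftrightarrow> integrable (Pi\<^sub>M Basis (\<lambda>_. lborel)) (\<lambda>f. ?F (?T f))"
    by (subst (1) lborel_eq, rule integrable_distr_eq) measurable
  then show "integrable lborel ?F"
    unfolding T by (simp add: product_integrable_prod h)
  have "integral\<^sup>L lborel ?F = integral\<^sup>L (Pi\<^sub>M Basis (\<lambda>_. lborel)) (\<lambda>f. ?F (?T f))"
    by (subst (1) lborel_eq, rule integral_distr) measurable
  then show "integral\<^sup>L lborel ?F = (\<Prod>b\<in>Basis. integral\<^sup>L lborel (h b))"
    unfolding T by (simp add: product_integral_prod h)
qed

lemma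
  fixes h :: "'n::finite \<Rightarrow> real \<Rightarrow> real"
  assumes h: "\<And>i. integrable lborel (h i)"
  shows integrable_lborel_prod_vec: "integrable lborel (\<lambda>x::real^'n. \<Prod>i\<in>UNIV. h i (x $ i))"
    and integral_lborel_prod_vec:
      "(\<integral>x. (\<Prod>i\<in>UNIV. h i ((x::real^'n) $ i)) \<partial>lborel) = (\<Prod>i\<in>UNIV. integral\<^sup>L lborel (h i))"
proof -
  let ?e = "\<lambda>i::'n. axis i (1::real)"
  have inj: "inj ?e"
    by (auto simp: inj_def axis_eq_axis)
  have Basis: "(Basis :: (real^'n) set) = range ?e"
    by (auto simp: Basis_vec_def)
  \<comment> \<open>The preceding lemma indexes factors by basis vectors; the injective map
    \<open>axis\<close> transfers them to coordinate indices.\<close>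
  define g where "g b = h (inv ?e b)" for b
  have g: "g (?e i) = h i" for i
    by (simp add: g_def inv_f_f[OF inj])
  have int: "integrable lborel (g b)" for b
    by (simp add: g_def h)
  have prod: "(\<Prod>b\<in>Basis. g b (x \<bullet> b)) = (\<Prod>i\<in>UNIV. h i (x $ i))" for x :: "real^'n"
    unfolding Basis by (subst prod.reindex[OF inj]) (simp add: g inner_axis)
  show "integrable lborel (\<lambda>x::real^'n. \<Prod>i\<in>UNIV. h i (x $ i))"
    using integrable_lborel_prod[of g] int by (simp add: prod)
  have "(\<Prod>b\<in>Basis. integral\<^sup>L lborel (g b)) = (\<Prod>i\<in>UNIV. integral\<^sup>L lborel (h i))"
    unfolding Basis by (subst prod.reindex[OF inj]) (simp add: g)
  then show "(\<integral>x. (\<Prod>i\<in>UNIV. h i ((x::real^'n) $ i)) \<partial>lborel) = (\<Prod>i\<in>UNIV. integral\<^sup>L lborel (h i))"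
    using integral_lborel_prod[of g] int by (simp add: prod)
qed

subsection \<open>Isotropic Gaussian vectors\<close>

lemma gaussian_density_isotropic:
  fixes x :: "real^'n"
  assumes "\<sigma> > 0"
  shows "gaussian_density \<mu> (\<sigma>\<^sup>2 *\<^sub>R mat 1) x =
     exp (- ((norm (x - \<mu>))\<^sup>2 / (2 * \<sigma>\<^sup>2))) / sqrt (2 * pi * \<sigma>\<^sup>2) ^ CARD('n)"
proof -
  have "(\<sigma>\<^sup>2 *\<^sub>R mat 1 :: real^'n^'n) ** ((1 / \<sigma>\<^sup>2) *\<^sub>R mat 1) = mat 1"
    using assms by (simp add: matrix_mult.scaleR_left matrix_mult.scaleR_right)
  then have inv: "matrix_inv (\<sigma>\<^sup>2 *\<^sub>R mat 1 :: real^'n^'n) = (1 / \<sigma>\<^sup>2) *\<^sub>R mat 1"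
    by (rule matrix_inv_eqI)
  have "det (\<sigma>\<^sup>2 *\<^sub>R mat 1 :: real^'n^'n) = (\<sigma>\<^sup>2) ^ CARD('n)"
    by (subst det_diagonal) (simp_all add: mat_def)
  then have "(2 * pi) ^ CARD('n) * det (\<sigma>\<^sup>2 *\<^sub>R mat 1 :: real^'n^'n) = (2 * pi * \<sigma>\<^sup>2) ^ CARD('n)"
    by (simp only: power_mult_distrib)
  then show ?thesis
    unfolding gaussian_density_def inv real_sqrt_power[symmetric]
    by (simp add: power2_norm_eq_inner flip: scaleR_matrix_vector_assoc)
qed

lemma gaussian_density_eq_prod_normal_density:
  fixes x :: "real^'n"
  assumes "\<sigma> > 0"
  shows "gaussian_density \<mu> (\<sigma>\<^sup>2 *\<^sub>R mat 1) x = (\<Prod>i\<in>UNIV. normal_density (\<mu> $ i) \<sigma> (x $ i))"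
proof -
  have "(norm (x - \<mu>))\<^sup>2 = (\<Sum>i\<in>UNIV. (x $ i - \<mu> $ i)\<^sup>2)"
    unfolding power2_norm_eq_inner inner_vec_def by (simp add: power2_eq_square)
  then have "exp (- ((norm (x - \<mu>))\<^sup>2 / (2 * \<sigma>\<^sup>2))) = (\<Prod>i\<in>UNIV. exp (- (x $ i - \<mu> $ i)\<^sup>2 / (2 * \<sigma>\<^sup>2)))"
    by (simp add: sum_divide_distrib sum_negf flip: exp_sum)
  then show ?thesis
    by (simp add: gaussian_density_isotropic assms normal_density_def prod_dividef)
qed

text \<open>The isotropic density is a product over coordinates, so monomials integrate
  coordinatewise. An arbitrary exponent function covers first moments, second moments and mixed
  products at once.\<close>

lemma
  fixes X :: "'w \<Rightarrow> real^'n" and e :: "'n \<Rightarrow> nat"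
  assumes \<sigma>: "\<sigma> > 0" and X: "gaussian_vector M X 0 (\<sigma>\<^sup>2 *\<^sub>R mat 1)"
  shows integrable_gaussian_monomial: "integrable M (\<lambda>w. \<Prod>i\<in>UNIV. (X w $ i) ^ e i)"
    and integral_gaussian_monomial: "(\<integral>w. (\<Prod>i\<in>UNIV. (X w $ i) ^ e i) \<partial>M) =
      (\<Prod>i\<in>UNIV. \<integral>x. normal_density 0 \<sigma> x * x ^ e i \<partial>lborel)"
proof -
  let ?f = "\<lambda>x::real^'n. \<Prod>i\<in>UNIV. normal_density 0 \<sigma> (x $ i)"
  have X: "distributed M lborel X ?f"
    using X \<sigma> by (simp add: gaussian_vector_def gaussian_density_eq_prod_normal_density)
  have nonneg: "0 \<le> ?f x" for x
    by (intro prod_nonneg) simp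
  have int: "integrable lborel (\<lambda>x. normal_density 0 \<sigma> x * x ^ e i)" for i
    using integrable_normal_moment[OF \<sigma>, of 0] by simp
  have [measurable]: "(\<lambda>x::real^'n. \<Prod>i\<in>UNIV. (x $ i) ^ e i) \<in> borel_measurable borel"
    by measurable
  show "integrable M (\<lambda>w. \<Prod>i\<in>UNIV. (X w $ i) ^ e i)"
    using distributed_integrable[OF X, of "\<lambda>x. \<Prod>i\<in>UNIV. (x $ i) ^ e i"] nonneg
      integrable_lborel_prod_vec[of "\<lambda>i x. normal_density 0 \<sigma> x * x ^ e i"] int by (simp add: prod.distrib)
  show "(\<integral>w. (\<Prod>i\<in>UNIV. (X w $ i) ^ e i) \<partial>M) =
      (\<Prod>i\<in>UNIV. \<integral>x. normal_density 0 \<sigma> x * x ^ e i \<partial>lborel)"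
    using distributed_integral[OF X, of "\<lambda>x. \<Prod>i\<in>UNIV. (x $ i) ^ e i"] nonneg
      integral_lborel_prod_vec[of "\<lambda>i x. normal_density 0 \<sigma> x * x ^ e i"] int by (simp add: prod.distrib)
qed

lemma
  fixes X :: "'w \<Rightarrow> real^'n"
  assumes \<sigma>: "\<sigma> > 0" and X: "gaussian_vector M X 0 (\<sigma>\<^sup>2 *\<^sub>R mat 1)"
  shows integrable_gaussian_component: "integrable M (\<lambda>w. X w $ a)"
    and integral_gaussian_component: "(\<integral>w. X w $ a \<partial>M) = 0"
    and integrable_gaussian_component_mult: "integrable M (\<lambda>w. X w $ a * X w $ b)"
    and integral_gaussian_component_mult:
      "(\<integral>w. X w $ a * X w $ b \<partial>M) = (if a = b then \<sigma>\<^sup>2 else 0)"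
proof -
  let ?m = "\<lambda>k. \<integral>x. normal_density 0 \<sigma> x * x ^ k \<partial>lborel"
  have m: "?m 0 = 1" "?m (Suc 0) = 0" "?m 2 = \<sigma>\<^sup>2"
    using \<sigma> integral_normal_moment_nz_1[OF \<sigma>, of 0] integral_normal_moment_even[OF \<sigma>, of 0 1]
    by (simp_all add: fact_numeral)
  \<comment> \<open>Kronecker exponents: \<open>?e a\<close> selects the coordinate
    \<open>a\<close>, and the sum of two of them selects a product of two coordinates.\<close>
  let ?e = "\<lambda>a i. if i = a then 1 else 0 :: nat"
  have e: "(\<Prod>i\<in>UNIV. x i ^ ?e a i) = x a" for x :: "'n \<Rightarrow> real" and a
    by (simp add: if_distrib cong: if_cong)
  have ee: "(\<Prod>i\<in>UNIV. x i ^ (?e a i + ?e b i)) = x a * x b" for x :: "'n \<Rightarrow> real" and a b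
    unfolding power_add prod.distrib e ..
  show "integrable M (\<lambda>w. X w $ a)"
    using integrable_gaussian_monomial[OF \<sigma> X, of "?e a"] unfolding e .
  have "?m (?e a a) = 0"
    using m by simp
  then have "(\<Prod>i\<in>UNIV. ?m (?e a i)) = 0"
    by (intro prod_zero) auto
  then show "(\<integral>w. X w $ a \<partial>M) = 0"
    using integral_gaussian_monomial[OF \<sigma> X, of "?e a"] unfolding e by simp
  show "integrable M (\<lambda>w. X w $ a * X w $ b)"
    using integrable_gaussian_monomial[OF \<sigma> X, of "\<lambda>i. ?e a i + ?e b i"] unfolding ee .
  \<comment> \<open>For equal indices the only nontrivial factor is the second moment; otherwise the
    factor at \<open>a\<close> is a first moment, which is zero.\<close>
  have "(\<Prod>i\<in>UNIV. ?m (?e a i + ?e b i)) = (if a = b then \<sigma>\<^sup>2 else 0)"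
  proof (cases "a = b")
    case True
    then have "(\<Prod>i\<in>UNIV. ?m (?e a i + ?e b i)) = (\<Prod>i\<in>UNIV. if i = a then \<sigma>\<^sup>2 else 1)"
      using m by (intro prod.cong) (auto simp flip: numeral_2_eq_2)
    then show ?thesis
      using True by simp
  next
    case False
    then have "?m (?e a a + ?e b a) = 0"
      using m by simp
    then show ?thesis
      using False by (subst prod_zero) auto
  qed
  then show "(\<integral>w. X w $ a * X w $ b \<partial>M) = (if a = b then \<sigma>\<^sup>2 else 0)"
    using integral_gaussian_monomial[OF \<sigma> X, of "\<lambda>i. ?e a i + ?e b i"] unfolding ee by (rule trans[rotated])
qed

text \<open>Translation invariance of Lebesgue measure: pushing the law forward by \<open>c\<close>
  only shifts the argument of the density.\<close>

lemma gaussian_vector_translate: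
  assumes "gaussian_vector M X \<mu> S"
  shows "gaussian_vector M (\<lambda>w. c + X w) (c + \<mu>) S"
proof -
  have X: "distributed M lborel X (\<lambda>x. ennreal (gaussian_density \<mu> S x))"
    using assms by (simp add: gaussian_vector_def)
  have X_meas [measurable]: "X \<in> borel_measurable M"
    and f [measurable]: "(\<lambda>x. ennreal (gaussian_density \<mu> S x)) \<in> borel_measurable borel"
    using distributed_measurable[OF X] distributed_borel_measurable[OF X] by simp_all
  have shift: "gaussian_density (c + \<mu>) S x = gaussian_density \<mu> S (x - c)" for x
    by (simp add: gaussian_density_def diff_diff_eq)
  have [measurable]: "(\<lambda>x. ennreal (gaussian_density \<mu> S (x - c))) \<in> borel_measurable borel"
    by (rule measurable_compose[OF _ f]) simp
  have "distr M lborel (\<lambda>w. c + X w) = distr (distr M lborel X) borel ((+) c)"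
    by (subst distr_distr) (simp_all add: comp_def cong: distr_cong)
  also have "\<dots> = distr (density lborel (\<lambda>x. ennreal (gaussian_density \<mu> S x))) borel ((+) c)"
    using distributed_distr_eq_density[OF X] by simp
  also have "\<dots> = density (distr lborel borel ((+) c)) (\<lambda>x. ennreal (gaussian_density \<mu> S (x - c)))"
    by (subst density_distr) simp_all
  also have "\<dots> = density lborel (\<lambda>x. ennreal (gaussian_density \<mu> S (x - c)))"
    by (simp add: lborel_distr_plus)
  finally show ?thesis
    by (simp add: gaussian_vector_def distributed_def shift)
qed

subsection \<open>Joint densities\<close>

text \<open>A product measure is determined by its values on boxes, where the integral of the
  product density factors.\<close>

lemma PiM_density:
  assumes "finite I"
    and "\<And>i. sigma_finite_measure (N i)"
    and f: "\<And>i. i \<in> I \<Longrightarrow> f i \<in> borel_measurable (N i)"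
    and "\<And>i. i \<in> I \<Longrightarrow> sigma_finite_measure (density (N i) (f i))"
  shows "(\<Pi>\<^sub>M i\<in>I. density (N i) (f i)) = density (\<Pi>\<^sub>M i\<in>I. N i) (\<lambda>y. \<Prod>i\<in>I. f i (y i))"
proof -
  \<comment> \<open>\<open>product_sigma_finite\<close> asks for sigma-finiteness at every index,
    while the densities are controlled on \<open>I\<close> only; outside, \<open>N i\<close> is
    kept.\<close>
  define L where "L i = (if i \<in> I then density (N i) (f i) else N i)" for i
  interpret L: product_sigma_finite L
    using assms(2,4) by (simp add: product_sigma_finite_def L_def)
  interpret N: product_sigma_finite N
    using assms(2) by (simp add: product_sigma_finite_def)
  note [measurable] = f
  have sets_L: "sets (L i) = sets (N i)" for i
    by (simp add: L_def)
  have "density (\<Pi>\<^sub>M i\<in>I. N i) (\<lambda>y. \<Prod>i\<in>I. f i (y i)) = PiM I L"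
  proof (rule L.PiM_eqI[OF \<open>finite I\<close>])
    show "sets (density (\<Pi>\<^sub>M i\<in>I. N i) (\<lambda>y. \<Prod>i\<in>I. f i (y i))) = sets (PiM I L)"
      by (simp add: sets_L cong: sets_PiM_cong)
  next
    fix A assume "\<And>i. i \<in> I \<Longrightarrow> A i \<in> sets (L i)"
    then have A [measurable]: "\<And>i. i \<in> I \<Longrightarrow> A i \<in> sets (N i)"
      by (simp add: sets_L)
    have [measurable]: "(\<lambda>y. \<Prod>i\<in>I. f i (y i)) \<in> borel_measurable (PiM I N)"
      by measurable
    have "Pi\<^sub>E I A \<in> sets (PiM I N)"
      using A \<open>finite I\<close> by (intro sets_PiM_I_finite)
    then have "emeasure (density (\<Pi>\<^sub>M i\<in>I. N i) (\<lambda>y. \<Prod>i\<in>I. f i (y i))) (Pi\<^sub>E I A) =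
        (\<integral>\<^sup>+y. (\<Prod>i\<in>I. f i (y i)) * indicator (Pi\<^sub>E I A) y \<partial>PiM I N)"
      by (subst emeasure_density) simp_all
    also have "\<dots> = (\<integral>\<^sup>+y. (\<Prod>i\<in>I. f i (y i) * indicator (A i) (y i)) \<partial>PiM I N)"
    proof (intro nn_integral_cong)
      fix y assume "y \<in> space (PiM I N)"
      then have "indicator (Pi\<^sub>E I A) y = (\<Prod>i\<in>I. indicator (A i) (y i) :: ennreal)"
        using \<open>finite I\<close> by (auto simp: space_PiM PiE_iff indicator_def prod_zero_iff)
      then show "(\<Prod>i\<in>I. f i (y i)) * indicator (Pi\<^sub>E I A) y =
          (\<Prod>i\<in>I. f i (y i) * indicator (A i) (y i))"
        by (simp add: prod.distrib)
    qed
    also have "\<dots> = (\<Prod>i\<in>I. \<integral>\<^sup>+x. f i x * indicator (A i) x \<partial>N i)"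
      using \<open>finite I\<close> by (intro N.product_nn_integral_prod) measurable
    also have "\<dots> = (\<Prod>i\<in>I. emeasure (L i) (A i))"
      using A by (intro prod.cong refl) (simp add: L_def emeasure_density)
    finally show "emeasure (density (\<Pi>\<^sub>M i\<in>I. N i) (\<lambda>y. \<Prod>i\<in>I. f i (y i))) (Pi\<^sub>E I A) =
        (\<Prod>i\<in>I. emeasure (L i) (A i))" .
  qed
  moreover have "PiM I L = (\<Pi>\<^sub>M i\<in>I. density (N i) (f i))"
    by (intro PiM_cong) (simp_all add: L_def)
  ultimately show ?thesis
    by simp
qed

lemma (in prob_space) distributed_indep_vars:
  assumes "finite I" "I \<noteq> {}"
    and indep: "indep_vars N X I"
    and N: "\<And>i. sigma_finite_measure (N i)"
    and X: "\<And>i. i \<in> I \<Longrightarrow> distributed M (N i) (X i) (f i)"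
  shows "distributed M (PiM I N) (\<lambda>w. \<lambda>i\<in>I. X i w) (\<lambda>y. \<Prod>i\<in>I. f i (y i))"
proof -
  have X_meas [measurable]: "X i \<in> measurable M (N i)"
    and f [measurable]: "f i \<in> borel_measurable (N i)"
    and distr: "distr M (N i) (X i) = density (N i) (f i)" if "i \<in> I" for i
    using X[OF that] by (simp_all add: distributed_def)
  \<comment> \<open>This density measure is the law of \<open>X i\<close>, hence a probability
    measure.\<close>
  have "sigma_finite_measure (density (N i) (f i))" if "i \<in> I" for i
    using prob_space_imp_sigma_finite[OF prob_space_distr[OF X_meas[OF that]]]
    by (simp add: distr that)
  then have "(\<Pi>\<^sub>M i\<in>I. density (N i) (f i)) = density (PiM I N) (\<lambda>y. \<Prod>i\<in>I. f i (y i))"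
    using assms f by (intro PiM_density) auto
  moreover have "distr M (PiM I N) (\<lambda>w. \<lambda>i\<in>I. X i w) = (\<Pi>\<^sub>M i\<in>I. distr M (N i) (X i))"
    using indep_vars_iff_distr_eq_PiM'[of I X N] \<open>I \<noteq> {}\<close> indep X_meas by blast
  moreover have "(\<Pi>\<^sub>M i\<in>I. distr M (N i) (X i)) = (\<Pi>\<^sub>M i\<in>I. density (N i) (f i))"
    by (intro PiM_cong) (simp_all add: distr)
  ultimately show ?thesis
    unfolding distributed_def by (auto intro!: measurable_restrict borel_measurable_prod_ennreal)
qed

lemma emeasure_lborel_open_pos:
  fixes U :: "'a::euclidean_space set"
  assumes "open U" "U \<noteq> {}"
  shows "emeasure lborel U \<noteq> 0"
proof
  assume "emeasure lborel U = 0"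
  then have "U \<in> null_sets lborel"
    using assms by (auto simp: null_sets_def)
  then have "negligible U"
    by (simp add: negligible_iff_null_sets null_sets_completionI)
  then show False
    using open_not_negligible assms by blast
qed

text \<open>Two densities of one variable agree almost everywhere. If continuous versions differed
  at \<open>y\<close>, they would differ on an open box around \<open>y\<close>, and such a box has
  positive measure.\<close>

lemma continuous_densities_eq:
  fixes f g :: "('i \<Rightarrow> 'a::euclidean_space) \<Rightarrow> real"
  assumes "finite I"
    and f: "distributed M (\<Pi>\<^sub>M i\<in>I. lborel) Y (\<lambda>y. ennreal (f y))"
      "\<forall>y\<in>PiE I (\<lambda>_. UNIV). f y \<ge> 0" "continuous_on (PiE I (\<lambda>_. UNIV)) f"
    and g: "distributed M (\<Pi>\<^sub>M i\<in>I. lborel) Y (\<lambda>y. ennreal (g y))"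
      "\<forall>y\<in>PiE I (\<lambda>_. UNIV). g y \<ge> 0" "continuous_on (PiE I (\<lambda>_. UNIV)) g"
    and y: "y \<in> PiE I (\<lambda>_. UNIV)"
  shows "f y = g y"
proof (rule ccontr)
  assume "f y \<noteq> g y"
  let ?P = "\<Pi>\<^sub>M i\<in>I. (lborel :: 'a measure)" and ?E = "PiE I (\<lambda>_. UNIV :: 'a set)"
  interpret product_sigma_finite "\<lambda>_::'i. lborel :: 'a measure" ..
  interpret sigma_finite_measure ?P
    by (intro sigma_finite \<open>finite I\<close>)
  have "density ?P (\<lambda>y. ennreal (f y)) = density ?P (\<lambda>y. ennreal (g y))"
    using distributed_distr_eq_density[OF f(1)] distributed_distr_eq_density[OF g(1)] by simp
  then have AE: "AE x in ?P. ennreal (f x) = ennreal (g x)"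
    using distributed_borel_measurable[OF f(1)] distributed_borel_measurable[OF g(1)]
    by (simp add: density_unique_iff)
  have "continuous_on ?E (\<lambda>x. f x - g x)"
    by (intro continuous_intros f g)
  then have "openin (top_of_set ?E) (?E \<inter> (\<lambda>x. f x - g x) -` (- {0}))"
    by (intro continuous_openin_preimage_gen) auto
  then obtain T where T: "open T" "?E \<inter> (\<lambda>x. f x - g x) -` (- {0}) = ?E \<inter> T"
    by (auto simp: openin_open)
  have "y \<in> T"
    using y T(2) \<open>f y \<noteq> g y\<close> by auto
  then obtain X where X: "y \<in> PiE UNIV X" "\<And>i. open (X i)" "PiE UNIV X \<subseteq> T"
    using product_topology_open_contains_basis[of "\<lambda>_. euclidean" UNIV T y] T(1)
    by (auto simp: open_fun_def)
  \<comment> \<open>The basic open set constrains all indices, the box only those in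
    \<open>I\<close>; elsewhere points of \<open>PiE\<close> take the default value
    \<open>undefined\<close>, as \<open>y\<close> does, so they satisfy the remaining
    constraints.\<close>
  have box_T: "PiE I X \<subseteq> ?E \<inter> T"
  proof
    fix x assume x: "x \<in> PiE I X"
    have "x i \<in> X i" for i
    proof (cases "i \<in> I")
      case False
      then have "x i = y i"
        using x y by (auto simp: PiE_iff extensional_def)
      then show ?thesis
        using X(1) by auto
    qed (use x in auto)
    then show "x \<in> ?E \<inter> T"
      using X(3) x by (auto simp: PiE_iff)
  qed
  have box: "PiE I X \<in> sets ?P"
    using X(2) \<open>finite I\<close> by (intro sets_PiM_I_finite) auto
  have "AE x in ?P. x \<notin> PiE I X"
    using AE
  proof eventually_elim
    case (elim x)
    show ?case
    proof
      assume "x \<in> PiE I X"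
      then have "x \<in> ?E" "f x \<noteq> g x"
        using box_T T(2) by auto
      then show False
        using elim f(2) g(2) by simp
    qed
  qed
  then have "emeasure ?P (PiE I X) = 0"
    using AE_iff_null_sets[OF box] by (auto simp: null_sets_def)
  moreover have "emeasure ?P (PiE I X) = (\<Prod>i\<in>I. emeasure lborel (X i))"
    using X(2) by (intro emeasure_PiM \<open>finite I\<close>) auto
  moreover have "emeasure lborel (X i) \<noteq> 0" for i
    using X(1,2) by (intro emeasure_lborel_open_pos) auto
  ultimately show False
    using \<open>finite I\<close> by (simp add: prod_zero_iff)
qed

subsection \<open>Likelihood and intrinsic Fisher information\<close>

text \<open>These are the hypotheses on the system alone; the filter and the invertibility at the
  first measurement enter later as premises.\<close>

locale attitude_measurements = prob_space M for M :: "'w measure" +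
  fixes om :: "real \<Rightarrow> real^3"
    and t :: "nat \<Rightarrow> real"
    and d :: "nat \<Rightarrow> nat \<Rightarrow> real^3"
    and \<sigma> :: "nat \<Rightarrow> nat \<Rightarrow> real"
    and V :: "nat \<Rightarrow> nat \<Rightarrow> 'w \<Rightarrow> real^3"
    and R :: "real \<Rightarrow> real^3^3"
  assumes t_mono: "\<And>k. k \<ge> 1 \<Longrightarrow> t k \<le> t (k + 1)"
    and trajectory_R: "attitude_trajectory om {t 1..} R"
    and \<sigma>_pos: "\<And>k i. k \<ge> 1 \<Longrightarrow> i \<in> {0, 1} \<Longrightarrow> \<sigma> k i > 0"
    and V_gaussian: "\<And>k i. k \<ge> 1 \<Longrightarrow> i \<in> {0, 1} \<Longrightarrow>
      gaussian_vector M (V k i) 0 ((\<sigma> k i)\<^sup>2 *\<^sub>R mat 1)"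
    and V_indep: "indep_vars (\<lambda>_. borel) (\<lambda>(k, i). V k i) ({1..} \<times> {0, 1})"
begin

text \<open>The channels are summed inside the sum over measurements, so that one further
  measurement adds one term, as the induction over updates requires.\<close>

definition information :: "nat \<Rightarrow> real^3^3" where
  "information n = (\<Sum>k=1..n. \<Sum>i\<in>{0, 1}.
     (1 / (\<sigma> k i)\<^sup>2) *\<^sub>R (transpose (skew (d k i)) ** skew (d k i)))"

lemma information_vector_mult:
  "information n *v x = (\<Sum>k=1..n. \<Sum>i\<in>{0, 1}.
     (1 / (\<sigma> k i)\<^sup>2) *\<^sub>R (transpose (skew (d k i)) *v cross3 (d k i) x))"
proof -
  interpret bounded_linear "\<lambda>A :: real^3^3. A *v x"
    unfolding linear_conv_bounded_linear[symmetric]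
    by (intro linearI) (simp_all add: matrix_vector_mult_add_rdistrib scaleR_matrix_vector_assoc)
  show ?thesis
    unfolding information_def sum scaleR matrix_vector_mul_assoc[symmetric] skew_vector_mult ..
qed

lemma information_quadratic_form:
  "x \<bullet> (information n *v x) =
     (\<Sum>k=1..n. \<Sum>i\<in>{0, 1}. (norm (cross3 (d k i) x))\<^sup>2 / (\<sigma> k i)\<^sup>2)"
proof -
  have "x \<bullet> (transpose (skew a) *v y) = cross3 a x \<bullet> y" for a y
    by (simp add: inner_transpose_vector_mult skew_vector_mult)
  then show ?thesis
    unfolding information_vector_mult inner_sum_right inner_scaleR_right
    by (simp add: power2_norm_eq_inner)
qed

lemma transpose_information: "transpose (information n) = information n"
proof -
  interpret bounded_linear "transpose :: real^3^3 \<Rightarrow> real^3^3"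
    by (rule bounded_linear_transpose)
  show ?thesis
    unfolding information_def sum scaleR by (simp add: matrix_transpose_mul)
qed

lemma t_ge_t1: "k \<ge> 1 \<Longrightarrow> t 1 \<le> t k"
  by (induction k rule: nat_induct_at_least) (use t_mono in \<open>force+\<close>)

lemma R_SO3: "k \<ge> 1 \<Longrightarrow> R (t k) \<in> SO3"
  using trajectory_R t_ge_t1 by (auto simp: attitude_trajectory_def)

text \<open>Mean of channel \<open>i\<close> of measurement \<open>k\<close> when the state at
  \<open>t n\<close> is \<open>Q\<close>: the trajectory through \<open>Q\<close> is
  \<open>Q ** transpose (R (t n)) ** R s\<close>, so the true trajectory serves in place of a
  flow.\<close>

definition likelihood_mean :: "nat \<Rightarrow> real^3^3 \<Rightarrow> nat \<Rightarrow> nat \<Rightarrow> real^3" where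
  "likelihood_mean n Q k i = transpose (R (t k)) *v (R (t n) *v (transpose Q *v d k i))"

definition likelihood :: "nat \<Rightarrow> real^3^3 \<Rightarrow> (nat \<times> nat \<Rightarrow> real^3) \<Rightarrow> real" where
  "likelihood n Q y = (\<Prod>(k, i)\<in>{1..n} \<times> {0, 1}.
     gaussian_density (likelihood_mean n Q k i) ((\<sigma> k i)\<^sup>2 *\<^sub>R mat 1) (y (k, i)))"

lemma mean_along_trajectory:
  assumes "attitude_trajectory om {t 1..} X" "k \<ge> 1" "n \<ge> 1"
  shows "transpose (X (t k)) *v d k i = likelihood_mean n (X (t n)) k i"
proof -
  have "X (t k) = X (t n) ** transpose (R (t n)) ** R (t k)"
    using assms trajectory_R t_ge_t1
    by (intro attitude_trajectory_transition[of "{t 1..}" om]) auto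
  then have "transpose (X (t k)) = transpose (R (t k)) ** (R (t n) ** transpose (X (t n)))"
    by (simp add: matrix_transpose_mul)
  then show ?thesis
    by (simp add: likelihood_mean_def matrix_vector_mul_assoc)
qed

lemma gaussian_density_channel_pos:
  assumes "k \<ge> 1" "i \<in> {0, 1}"
  shows "gaussian_density \<mu> ((\<sigma> k i)\<^sup>2 *\<^sub>R mat 1) (x :: real^3) > 0"
  using \<sigma>_pos[OF assms] by (simp add: gaussian_density_isotropic)

text \<open>Along any trajectory the measurements are deterministic translates of the independent
  noises, hence independent Gaussians with the means just computed.\<close>

lemma is_likelihood_likelihood:
  assumes "n \<ge> 1"
  shows "is_likelihood M om t d V n (likelihood n)"
  unfolding is_likelihood_def
proof (intro allI impI conjI)
  fix X assume X: "attitude_trajectory om {t 1..} X"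
  let ?I = "{1..n} \<times> {0, 1 :: nat}"
  let ?Y = "\<lambda>(k, i). measurement t d V X k i"
  let ?f = "\<lambda>(k, i) x. ennreal (gaussian_density (likelihood_mean n (X (t n)) k i)
     ((\<sigma> k i)\<^sup>2 *\<^sub>R mat 1) x)"
  have "distributed M (\<Pi>\<^sub>M p\<in>?I. lborel) (\<lambda>w. \<lambda>p\<in>?I. ?Y p w) (\<lambda>y. \<Prod>p\<in>?I. ?f p (y p))"
  proof (rule distributed_indep_vars)
    have "indep_vars (\<lambda>_. borel) (\<lambda>(k, i). V k i) ?I"
      by (rule indep_vars_subset[OF V_indep]) auto
    then have "indep_vars (\<lambda>_. lborel)
        (\<lambda>p w. transpose (X (t (fst p))) *v d (fst p) (snd p) + (case p of (k, i) \<Rightarrow> V k i) w) ?I"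
      by (rule indep_vars_compose2) simp
    then show "indep_vars (\<lambda>_. lborel) ?Y ?I"
      by (simp add: measurement_def[abs_def] case_prod_unfold)
  next
    fix p assume "p \<in> ?I"
    then obtain k i where p: "p = (k, i)" "k \<ge> 1" "i \<in> {0, 1}"
      by auto
    have "gaussian_vector M (\<lambda>w. transpose (X (t k)) *v d k i + V k i w)
        (likelihood_mean n (X (t n)) k i) ((\<sigma> k i)\<^sup>2 *\<^sub>R mat 1)"
      using gaussian_vector_translate[OF V_gaussian[OF p(2,3)]] mean_along_trajectory[OF X p(2) assms]
      by simp
    then show "distributed M lborel (?Y p) (?f p)"
      by (simp add: p(1) gaussian_vector_def measurement_def[abs_def])
  qed (use assms in \<open>auto intro: lborel.sigma_finite_measure_axioms\<close>)
  moreover have "(\<lambda>w. \<lambda>p\<in>?I. ?Y p w) = observations t d V X n"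
    by (auto simp: observations_def fun_eq_iff restrict_def)
  moreover have "(\<Prod>p\<in>?I. ?f p (y p)) = ennreal (likelihood n (X (t n)) y)" for y
    unfolding likelihood_def case_prod_unfold prod.collapse
    by (intro prod_ennreal gaussian_density_channel_pos[THEN less_imp_le]) auto
  ultimately show "distributed M (\<Pi>\<^sub>M p\<in>?I. lborel) (observations t d V X n)
      (\<lambda>y. ennreal (likelihood n (X (t n)) y))"
    by simp
  have "0 \<le> likelihood n Q y" for Q y
    unfolding likelihood_def
  proof (rule prod_nonneg)
    fix p assume "p \<in> ?I"
    then obtain k i where "p = (k, i)" "k \<ge> 1" "i \<in> {0, 1}"
      by auto
    then show "0 \<le> (case p of (k, i) \<Rightarrow>
        gaussian_density (likelihood_mean n Q k i) ((\<sigma> k i)\<^sup>2 *\<^sub>R mat 1) (y (k, i)))"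
      using gaussian_density_channel_pos[of k i] by (simp add: less_imp_le)
  qed
  then show "\<forall>y\<in>PiE ?I (\<lambda>_. UNIV). 0 \<le> likelihood n (X (t n)) y"
    by blast
  have "continuous_on S (\<lambda>y. gaussian_density \<mu> ((\<sigma> k i)\<^sup>2 *\<^sub>R mat 1) (y (k, i)))"
    if "(k, i) \<in> ?I" for k i \<mu> and S :: "(nat \<times> nat \<Rightarrow> real^3) set"
  proof -
    have \<sigma>: "\<sigma> k i > 0"
      using that by (intro \<sigma>_pos) auto
    then have "sqrt (2 * pi * (\<sigma> k i)\<^sup>2) ^ CARD(3) \<noteq> 0"
      by simp
    moreover have "continuous_on S (\<lambda>y. y (k, i))"
      by (rule continuous_on_product_then_coordinatewise[OF continuous_on_id])
    ultimately show ?thesis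
      unfolding gaussian_density_isotropic[OF \<sigma>]
      using \<sigma> by (intro continuous_intros) auto
  qed
  then show "continuous_on (PiE ?I (\<lambda>_. UNIV)) (likelihood n (X (t n)))"
    unfolding likelihood_def[abs_def] case_prod_unfold
    by (intro continuous_on_prod) (auto simp: mem_Times_iff)
qed

text \<open>\<open>is_likelihood\<close> constrains \<open>p\<close> only at states reached by
  trajectories and at points of the product space. Continuity of the densities makes them equal
  pointwise there.\<close>

lemma likelihood_unique:
  assumes "n \<ge> 1" "is_likelihood M om t d V n p" "Q \<in> SO3"
    and "y \<in> PiE ({1..n} \<times> {0, 1}) (\<lambda>_. UNIV)"
  shows "p Q y = likelihood n Q y"
proof -
  have n: "R (t n) \<in> SO3"
    using R_SO3 assms by blast
  \<comment> \<open>The left translate of the true trajectory that passes through \<open>Q\<close>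
    at time \<open>t n\<close>.\<close>
  let ?X = "\<lambda>s. (Q ** transpose (R (t n))) ** R s"
  have traj: "attitude_trajectory om {t 1..} ?X"
    using assms n trajectory_R by (intro attitude_trajectory_left_mult SO3_mult SO3_transpose)
  have Q: "?X (t n) = Q"
    by (simp add: SO3_orthogonal(2)[OF n] flip: matrix_mul_assoc)
  note densities = assms(2)[unfolded is_likelihood_def, rule_format, OF traj, unfolded Q]
    is_likelihood_likelihood[OF assms(1), unfolded is_likelihood_def, rule_format, OF traj, unfolded Q]
  show ?thesis
    by (rule continuous_densities_eq[of "{1..n} \<times> {0, 1}" M "observations t d V ?X n"])
       (use densities assms(4) in \<open>blast | simp\<close>)+
qed

definition log_likelihood_second_derivative :: "nat \<Rightarrow> real^3 \<Rightarrow> 'w \<Rightarrow> real" where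
  "log_likelihood_second_derivative n \<xi> w = (\<Sum>(k, i)\<in>{1..n} \<times> {0, 1}.
     cross3 \<xi> (cross3 \<xi> (R (t k) *v V k i w + d k i)) \<bullet> d k i / (\<sigma> k i)\<^sup>2)"

text \<open>Rotated by \<open>R (t k)\<close>, the residual of a channel is
  \<open>v - transpose A *v d\<close>, where v is the rotated noise plus d. Since rotations preserve
  norms, only the cross term of its square depends on \<open>A\<close>, and it does so
  linearly.\<close>

lemma ln_likelihood:
  assumes "n \<ge> 1"
  obtains c where "\<And>A. A \<in> SO3 \<Longrightarrow>
    ln (likelihood n (A ** R (t n)) (observations t d V R n w)) =
      c + (\<Sum>(k, i)\<in>{1..n} \<times> {0, 1}. (A *v (R (t k) *v V k i w + d k i)) \<bullet> d k i / (\<sigma> k i)\<^sup>2)"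
proof -
  let ?I = "{1..n} \<times> {0, 1 :: nat}"
  define v where "v k i = R (t k) *v V k i w + d k i" for k i
  \<comment> \<open>Everything independent of \<open>A\<close>: the two squared norms and the
    normalizing factor of the Gaussian.\<close>
  define c where "c k i = - ((norm (v k i))\<^sup>2 + (norm (d k i))\<^sup>2) / (2 * (\<sigma> k i)\<^sup>2)
    - ln (sqrt (2 * pi * (\<sigma> k i)\<^sup>2) ^ CARD(3))" for k i
  have "ln (likelihood n (A ** R (t n)) (observations t d V R n w)) =
      (\<Sum>(k, i)\<in>?I. c k i) + (\<Sum>(k, i)\<in>?I. (A *v v k i) \<bullet> d k i / (\<sigma> k i)\<^sup>2)"
    if A: "A \<in> SO3" for A
  proof -
    have channel: "ln (gaussian_density (likelihood_mean n (A ** R (t n)) k i) ((\<sigma> k i)\<^sup>2 *\<^sub>R mat 1)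
        (measurement t d V R k i w)) = c k i + (A *v v k i) \<bullet> d k i / (\<sigma> k i)\<^sup>2"
      if ki: "k \<ge> 1" "i \<in> {0, 1}" for k i
    proof -
      let ?T = "transpose (R (t k))"
      have "likelihood_mean n (A ** R (t n)) k i = ?T *v (transpose A *v d k i)"
      proof -
        have "R (t n) ** (transpose (R (t n)) ** transpose A) = transpose A"
          using SO3_orthogonal(1)[OF R_SO3[OF assms]] by (simp add: matrix_mul_assoc)
        then show ?thesis
          by (simp add: likelihood_mean_def matrix_transpose_mul matrix_vector_mul_assoc)
      qed
      moreover have "measurement t d V R k i w = ?T *v v k i"
        using SO3_orthogonal(2)[OF R_SO3[OF ki(1)]]
        by (simp add: measurement_def v_def matrix_vector_right_distrib matrix_vector_mul_assoc)
      ultimately have diff: "measurement t d V R k i w - likelihood_mean n (A ** R (t n)) k i =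
          ?T *v (v k i - transpose A *v d k i)"
        by (simp add: matrix_vector_mult_diff_distrib)
      have "orthogonal_transformation ((*v) ?T)" "orthogonal_transformation ((*v) (transpose A))"
        using SO3_transpose[OF R_SO3[OF ki(1)]] SO3_transpose[OF A]
        by (simp_all add: SO3_def rotation_matrix_def orthogonal_transformation_matrix)
      then have "(norm (?T *v (v k i - transpose A *v d k i)))\<^sup>2 =
          (norm (v k i))\<^sup>2 + (norm (d k i))\<^sup>2 - 2 * (v k i \<bullet> (transpose A *v d k i))"
        unfolding power2_norm_eq_inner
        by (simp add: orthogonal_transformation_def inner_diff inner_commute)
      also have "v k i \<bullet> (transpose A *v d k i) = (A *v v k i) \<bullet> d k i"
        by (rule inner_transpose_vector_mult)
      finally have "(norm (measurement t d V R k i w - likelihood_mean n (A ** R (t n)) k i))\<^sup>2 =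
          (norm (v k i))\<^sup>2 + (norm (d k i))\<^sup>2 - 2 * ((A *v v k i) \<bullet> d k i)"
        unfolding diff .
      then show ?thesis
        using \<sigma>_pos[OF ki]
        by (simp add: gaussian_density_isotropic c_def ln_div field_simps)
    qed
    have "ln (likelihood n (A ** R (t n)) (observations t d V R n w)) =
        (\<Sum>(k, i)\<in>?I. ln (gaussian_density (likelihood_mean n (A ** R (t n)) k i)
          ((\<sigma> k i)\<^sup>2 *\<^sub>R mat 1) (measurement t d V R k i w)))"
      unfolding likelihood_def case_prod_unfold
      by (subst ln_prod)
         (auto intro!: sum.cong simp: observations_def
           gaussian_density_channel_pos[THEN less_imp_neq, symmetric])
    also have "\<dots> = (\<Sum>(k, i)\<in>?I. c k i + (A *v v k i) \<bullet> d k i / (\<sigma> k i)\<^sup>2)"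
      by (intro sum.cong refl) (auto simp: channel)
    finally show ?thesis
      by (simp add: sum.distrib case_prod_unfold)
  qed
  then show ?thesis
    using that unfolding v_def by blast
qed

lemma log_likelihood_has_second_derivative:
  assumes "n \<ge> 1"
  shows "has_second_derivative
    (\<lambda>s. ln (likelihood n (exp_SO3 (s *\<^sub>R \<xi>) ** R (t n)) (observations t d V R n w)))
    (log_likelihood_second_derivative n \<xi> w) 0"
proof -
  let ?I = "{1..n} \<times> {0, 1 :: nat}"
  define v where "v k i = R (t k) *v V k i w + d k i" for k i
  \<comment> \<open>Contributions of the identity, of \<open>skew \<xi>\<close> and of its square to
    the log-likelihood. The coefficient functions have second derivatives 0 and 1 at 0, so
    \<open>a2\<close> alone survives.\<close>
  define a0 a1 a2 where "a0 = (\<Sum>(k, i)\<in>?I. v k i \<bullet> d k i / (\<sigma> k i)\<^sup>2)"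
    and "a1 = (\<Sum>(k, i)\<in>?I. cross3 \<xi> (v k i) \<bullet> d k i / (\<sigma> k i)\<^sup>2)"
    and "a2 = (\<Sum>(k, i)\<in>?I. cross3 \<xi> (cross3 \<xi> (v k i)) \<bullet> d k i / (\<sigma> k i)\<^sup>2)"
  obtain c where c: "\<And>A. A \<in> SO3 \<Longrightarrow>
      ln (likelihood n (A ** R (t n)) (observations t d V R n w)) =
        c + (\<Sum>(k, i)\<in>?I. (A *v v k i) \<bullet> d k i / (\<sigma> k i)\<^sup>2)"
    using ln_likelihood[OF assms, of w] unfolding v_def by blast
  obtain f g where E: "\<And>s. exp_SO3 (s *\<^sub>R \<xi>) = mat 1 + f s *\<^sub>R skew \<xi> + g s *\<^sub>R (skew \<xi> ** skew \<xi>)"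
    and f: "has_second_derivative f 0 0" and g: "has_second_derivative g 1 0"
    using exp_SO3_second_order by blast
  have mult: "exp_SO3 (s *\<^sub>R \<xi>) *v x = x + f s *\<^sub>R cross3 \<xi> x + g s *\<^sub>R cross3 \<xi> (cross3 \<xi> x)" for s x
    unfolding E matrix_vector_mult_add_rdistrib scaleR_matrix_vector_assoc[symmetric]
      matrix_vector_mul_assoc[symmetric] skew_vector_mult by simp
  have "ln (likelihood n (exp_SO3 (s *\<^sub>R \<xi>) ** R (t n)) (observations t d V R n w)) =
      (c + a0) + f s * a1 + g s * a2" for s
    unfolding c[OF exp_SO3_in_SO3] mult a0_def a1_def a2_def
    by (simp add: case_prod_unfold inner_add_left add_divide_distrib sum.distrib sum_distrib_left)
  then show ?thesis
    using has_second_derivative_linear_combination[OF f g, of "c + a0" a1 a2]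
    by (simp add: log_likelihood_second_derivative_def a2_def v_def mult.commute)
qed

lemma
  shows integrable_log_likelihood_second_derivative:
      "integrable M (log_likelihood_second_derivative n \<xi>)"
    and integral_log_likelihood_second_derivative:
      "(\<integral>w. log_likelihood_second_derivative n \<xi> w \<partial>M) = - (\<xi> \<bullet> (information n *v \<xi>))"
proof -
  let ?I = "{1..n} \<times> {0, 1 :: nat}"
  let ?W = "\<lambda>k i. transpose (R (t k)) *v cross3 \<xi> (cross3 \<xi> (d k i))"
  have int: "integrable M (\<lambda>w. V k i w \<bullet> a)" and zero: "(\<integral>w. V k i w \<bullet> a \<partial>M) = 0"
    if "k \<ge> 1" "i \<in> {0, 1}" for k i and a :: "real^3"
    using integrable_gaussian_component[OF \<sigma>_pos V_gaussian] that
      integral_gaussian_component[OF \<sigma>_pos V_gaussian]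
    by (simp_all add: inner_vec_def)
  \<comment> \<open>The double cross product is self-adjoint. Moved onto \<open>d k i\<close>, it
    leaves the noise paired with a fixed vector, which has mean zero, and a deterministic term equal
    to minus a squared norm.\<close>
  have expand: "cross3 \<xi> (cross3 \<xi> (R (t k) *v V k i w + d k i)) \<bullet> d k i =
      V k i w \<bullet> ?W k i - (norm (cross3 (d k i) \<xi>))\<^sup>2" for k i w
  proof -
    have swap: "cross3 \<xi> (cross3 \<xi> x) \<bullet> y = x \<bullet> cross3 \<xi> (cross3 \<xi> y)" for x y
      by (simp add: cross3_simps)
    have "(R (t k) *v x) \<bullet> y = x \<bullet> (transpose (R (t k)) *v y)" for x y
      by (rule inner_transpose_vector_mult[symmetric])
    moreover have "d k i \<bullet> cross3 \<xi> (cross3 \<xi> (d k i)) = - (norm (cross3 (d k i) \<xi>))\<^sup>2"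
      unfolding power2_norm_eq_inner by (simp add: cross3_simps)
    ultimately show ?thesis
      unfolding swap by (simp add: inner_add_left)
  qed
  have D: "log_likelihood_second_derivative n \<xi> = (\<lambda>w. \<Sum>p\<in>?I.
      (V (fst p) (snd p) w \<bullet> ?W (fst p) (snd p) - (norm (cross3 (d (fst p) (snd p)) \<xi>))\<^sup>2)
        / (\<sigma> (fst p) (snd p))\<^sup>2)"
    by (simp add: log_likelihood_second_derivative_def expand fun_eq_iff case_prod_unfold)
  show "integrable M (log_likelihood_second_derivative n \<xi>)"
    unfolding D by (intro Bochner_Integration.integrable_sum integrable_divide
        Bochner_Integration.integrable_diff int) auto
  have "(\<integral>w. log_likelihood_second_derivative n \<xi> w \<partial>M) =
      (\<Sum>p\<in>?I. - ((norm (cross3 (d (fst p) (snd p)) \<xi>))\<^sup>2 / (\<sigma> (fst p) (snd p))\<^sup>2))"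
    unfolding D using int zero
    by (subst Bochner_Integration.integral_sum)
       (auto intro!: sum.cong simp: prob_space)
  then show "(\<integral>w. log_likelihood_second_derivative n \<xi> w \<partial>M) = - (\<xi> \<bullet> (information n *v \<xi>))"
    by (simp add: information_quadratic_form sum.cartesian_product sum_negf case_prod_unfold
        del: sum.insert)
qed

text \<open>The definition allows any likelihood and any pointwise second derivative. Both are
  unique where they are evaluated, so the quadratic form is forced, and polarization then forces the
  matrix.\<close>

theorem is_fisher_information_iff:
  assumes "n \<ge> 1"
  shows "is_fisher_information M om t d V R n J \<longleftrightarrow> J = information n"
proof
  assume "J = information n"
  then show "is_fisher_information M om t d V R n J"
    unfolding is_fisher_information_def
  proof (intro conjI exI[of _ "likelihood n"] allI)
    fix \<xi>
    show "\<exists>D. (\<forall>w\<in>space M. has_second_derivative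
        (\<lambda>s. ln (likelihood n (exp_SO3 (s *\<^sub>R \<xi>) ** R (t n)) (observations t d V R n w))) (D w) 0) \<and>
      integrable M D \<and> \<xi> \<bullet> (J *v \<xi>) = - (\<integral>w. D w \<partial>M)"
      using log_likelihood_has_second_derivative[OF assms]
      by (intro exI[of _ "log_likelihood_second_derivative n \<xi>"])
         (simp add: integrable_log_likelihood_second_derivative
           integral_log_likelihood_second_derivative \<open>J = information n\<close>)
  qed (simp_all add: \<open>J = information n\<close> transpose_information is_likelihood_likelihood[OF assms])
next
  assume "is_fisher_information M om t d V R n J"
  then obtain p where sym: "transpose J = J" and p: "is_likelihood M om t d V n p"
    and D: "\<And>\<xi>. \<exists>D. (\<forall>w\<in>space M. has_second_derivative
        (\<lambda>s. ln (p (exp_SO3 (s *\<^sub>R \<xi>) ** R (t n)) (observations t d V R n w))) (D w) 0) \<and>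
      integrable M D \<and> \<xi> \<bullet> (J *v \<xi>) = - (\<integral>w. D w \<partial>M)"
    unfolding is_fisher_information_def by blast
  have "\<xi> \<bullet> (J *v \<xi>) = \<xi> \<bullet> (information n *v \<xi>)" for \<xi>
  proof -
    obtain D where D: "\<And>w. w \<in> space M \<Longrightarrow> has_second_derivative
          (\<lambda>s. ln (p (exp_SO3 (s *\<^sub>R \<xi>) ** R (t n)) (observations t d V R n w))) (D w) 0"
      and J: "\<xi> \<bullet> (J *v \<xi>) = - (\<integral>w. D w \<partial>M)"
      using D by blast
    have "p (exp_SO3 (s *\<^sub>R \<xi>) ** R (t n)) (observations t d V R n w) =
        likelihood n (exp_SO3 (s *\<^sub>R \<xi>) ** R (t n)) (observations t d V R n w)" for s w
    proof (rule likelihood_unique[OF assms p])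
      show "exp_SO3 (s *\<^sub>R \<xi>) ** R (t n) \<in> SO3"
        by (intro SO3_mult exp_SO3_in_SO3 R_SO3 assms)
      show "observations t d V R n w \<in> PiE ({1..n} \<times> {0, 1}) (\<lambda>_. UNIV)"
        by (simp add: observations_def)
    qed
    then have "D w = log_likelihood_second_derivative n \<xi> w" if "w \<in> space M" for w
      using D[OF that] log_likelihood_has_second_derivative[OF assms, of \<xi> w]
      by (auto intro: has_second_derivative_unique)
    then show ?thesis
      using J integral_log_likelihood_second_derivative[of n \<xi>]
      by (simp cong: Bochner_Integration.integral_cong)
  qed
  then show "J = information n"
    by (rule symmetric_matrix_eqI[OF sym transpose_information])
qed

end

subsection \<open>The Kalman gain in information form\<close>

text \<open>With innovation covariance \<open>S = H ** P ** transpose H + N\<close> and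
  \<open>C ** P = mat 1\<close>, the product \<open>C' ** P ** transpose H\<close> equals
  \<open>transpose H ** N' ** S\<close>; the inverse of \<open>S\<close> in the gain then cancels.
  No formula for the inverse of \<open>C'\<close> is involved.\<close>

lemma kalman_gain_information_form:
  fixes C :: "real^'n^'n" and H :: "real^'n^'m" and N N' :: "real^'m^'m"
  assumes C: "\<And>x. x \<noteq> 0 \<Longrightarrow> x \<bullet> (C *v x) > 0"
    and N: "\<And>x. x \<noteq> 0 \<Longrightarrow> x \<bullet> (N *v x) > 0"
    and N': "N' ** N = mat 1"
  defines "C' \<equiv> C + transpose H ** N' ** H"
    and "K \<equiv> kalman_gain (matrix_inv C) H N"
  shows "C' ** K = transpose H ** N'" and "C' ** (mat 1 - K ** H) = C"
proof -
  let ?P = "matrix_inv C"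
  let ?S = "H ** ?P ** transpose H + N"
  have CP: "C ** ?P = mat 1"
    using positive_definite_invertible[OF C] by (rule matrix_inv_right)
  have P: "y \<bullet> (?P *v y) \<ge> 0" for y
  proof -
    \<comment> \<open>Writing \<open>y\<close> in this way turns the quadratic form of the inverse
      at \<open>y\<close> into that of \<open>C\<close> at \<open>?P *v y\<close>.\<close>
    have "y = C *v (?P *v y)"
      by (simp add: matrix_vector_mul_assoc CP)
    then show ?thesis
      using C[of "?P *v y"] by (cases "?P *v y = 0") (auto simp: inner_commute less_imp_le)
  qed
  have "x \<bullet> (?S *v x) > 0" if "x \<noteq> 0" for x
  proof -
    have "x \<bullet> (?S *v x) = (transpose H *v x) \<bullet> (?P *v (transpose H *v x)) + x \<bullet> (N *v x)"
      using inner_transpose_vector_mult[of x "transpose H"]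
      by (simp add: matrix_vector_mult_add_rdistrib inner_add_right flip: matrix_vector_mul_assoc)
    then show ?thesis
      using P N[OF that] by (simp add: add_nonneg_pos)
  qed
  then have S: "?S ** matrix_inv ?S = mat 1"
    by (intro matrix_inv_right positive_definite_invertible)
  have "C' ** (?P ** transpose H) = (C ** ?P) ** transpose H + transpose H ** N' ** (H ** ?P ** transpose H)"
    by (simp add: C'_def matrix_mult.add_left matrix_mul_assoc)
  \<comment> \<open>The identity is written as \<open>N' ** N\<close> so that
    \<open>transpose H ** N'\<close> factors out of both terms.\<close>
  also have "\<dots> = transpose H ** (N' ** N) + transpose H ** N' ** (H ** ?P ** transpose H)"
    by (simp add: CP N')
  also have "\<dots> = transpose H ** N' ** ?S"
    by (simp add: matrix_mult.add_right matrix_mul_assoc)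
  finally have "C' ** K = transpose H ** N' ** (?S ** matrix_inv ?S)"
    by (simp add: K_def kalman_gain_def matrix_mul_assoc)
  then show K: "C' ** K = transpose H ** N'"
    by (simp add: S)
  have "C' ** (mat 1 - K ** H) = C' - (C' ** K) ** H"
    by (simp add: matrix_mult.diff_right matrix_mul_assoc)
  then show "C' ** (mat 1 - K ** H) = C"
    unfolding K by (simp add: C'_def)
qed

section \<open>Stacked vectors, block diagonal matrices and the two-channel update\<close>

lemma sum_UNIV_sum_type:
  "(\<Sum>i\<in>UNIV. f i) = (\<Sum>i\<in>UNIV. f (Inl i)) + (\<Sum>j\<in>UNIV. f (Inr j))"
  for f :: "'a::finite + 'b::finite \<Rightarrow> 'c::comm_monoid_add"
  by (subst UNIV_Plus_UNIV[symmetric], subst sum.Plus) (simp_all add: comp_def)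

lemma stack_cases:
  obtains u v where "x = stack u v"
proof
  show "x = stack (\<chi> i. x $ Inl i) (\<chi> j. x $ Inr j)"
    by (auto simp: stack_def vec_eq_iff split: sum.splits)
qed

lemma stack_zero: "stack 0 0 = 0"
  by (auto simp: stack_def vec_eq_iff split: sum.splits)

lemma inner_stack: "stack u v \<bullet> stack u' v' = u \<bullet> u' + v \<bullet> v'" for u u' :: "real^'m" and v v' :: "real^'n"
  by (simp add: stack_def inner_vec_def sum_UNIV_sum_type)

lemma stack_vector_mult: "stack A B *v x = stack (A *v x) (B *v x)"
  for A :: "real^'k^'m" and B :: "real^'k^'n"
  by (auto simp: stack_def vec_eq_iff matrix_vector_mult_def split: sum.splits)

lemma transpose_stack_vector_mult:
  "transpose (stack A B) *v stack u v = transpose A *v u + transpose B *v v"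
  for A :: "real^'k^'m" and B :: "real^'k^'n"
  by (simp add: stack_def vec_eq_iff matrix_vector_mult_def transpose_def sum_UNIV_sum_type)

lemma block_diag_vector_mult: "block_diag A B *v stack u v = stack (A *v u) (B *v v)"
  for A :: "real^'m^'m" and B :: "real^'n^'n"
  by (auto simp: block_diag_def stack_def vec_eq_iff matrix_vector_mult_def sum_UNIV_sum_type
      split: sum.splits)

lemma scalar_mat_vector_mult: "(c *\<^sub>R mat 1) *v x = c *\<^sub>R x" for x :: "real^'n"
  by (simp flip: scaleR_matrix_vector_assoc)

lemma block_diag_scalar_vector_mult:
  "block_diag (a *\<^sub>R mat 1) (b *\<^sub>R mat 1) *v stack u v = stack (a *\<^sub>R u) (b *\<^sub>R v)"
  for u :: "real^'m" and v :: "real^'n"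
  unfolding block_diag_vector_mult scalar_mat_vector_mult ..

text \<open>Multiplied by the new information matrix, the error update becomes an addition. It holds
  outcome by outcome, so covariances need no recursion of their own and independence is used only
  once, for the accumulated noise.\<close>

lemma kalman_update_information_form:
  fixes C :: "real^'n^'n" and H0 :: "real^'n^'m" and H1 :: "real^'n^'k"
  assumes C: "\<And>x. x \<noteq> 0 \<Longrightarrow> x \<bullet> (C *v x) > 0" and "a > 0" "b > 0"
  defines "C' \<equiv> C + (1 / a) *\<^sub>R (transpose H0 ** H0) + (1 / b) *\<^sub>R (transpose H1 ** H1)"
    and "K \<equiv> kalman_gain (matrix_inv C) (stack H0 H1) (block_diag (a *\<^sub>R mat 1) (b *\<^sub>R mat 1))"
  shows "C' *v ((mat 1 - K ** stack H0 H1) *v x + K *v stack u v) =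
    C *v x + ((1 / a) *\<^sub>R (transpose H0 *v u) + (1 / b) *\<^sub>R (transpose H1 *v v))"
proof -
  let ?H = "stack H0 H1"
  let ?N = "block_diag (a *\<^sub>R mat 1) (b *\<^sub>R mat 1) :: real^('m+'k)^('m+'k)"
  let ?N' = "block_diag ((1 / a) *\<^sub>R mat 1) ((1 / b) *\<^sub>R mat 1) :: real^('m+'k)^('m+'k)"
  have N: "x \<bullet> (?N *v x) > 0" if "x \<noteq> 0" for x
  proof -
    obtain u v where x: "x = stack u v"
      by (rule stack_cases)
    have "u \<noteq> 0 \<or> v \<noteq> 0"
      using that stack_zero unfolding x by metis
    then have "a * (u \<bullet> u) + b * (v \<bullet> v) > 0"
      using \<open>a > 0\<close> \<open>b > 0\<close>
      by (auto intro: add_pos_nonneg add_nonneg_pos simp: inner_gt_zero_iff)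
    then show ?thesis
      by (simp add: x block_diag_scalar_vector_mult inner_stack)
  qed
  have N': "?N' ** ?N = mat 1"
  proof (unfold matrix_eq, rule allI)
    fix x :: "real^('m+'k)"
    obtain u v where "x = stack u v"
      by (rule stack_cases)
    then show "(?N' ** ?N) *v x = mat 1 *v x"
      using assms(2,3) by (simp add: block_diag_scalar_vector_mult flip: matrix_vector_mul_assoc)
  qed
  have HN: "(transpose ?H ** ?N') *v stack u v =
      (1 / a) *\<^sub>R (transpose H0 *v u) + (1 / b) *\<^sub>R (transpose H1 *v v)" for u v
    by (simp add: block_diag_scalar_vector_mult transpose_stack_vector_mult matrix_vector_mult_scaleR
        flip: matrix_vector_mul_assoc)
  have "transpose ?H ** ?N' ** ?H =
      (1 / a) *\<^sub>R (transpose H0 ** H0) + (1 / b) *\<^sub>R (transpose H1 ** H1)"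
    unfolding matrix_eq
    by (simp add: HN stack_vector_mult matrix_vector_mult_add_rdistrib
        flip: matrix_vector_mul_assoc[of _ H0] matrix_vector_mul_assoc[of _ H1]
          matrix_vector_mul_assoc[of _ ?H] scaleR_matrix_vector_assoc)
  then have C': "C' = C + transpose ?H ** ?N' ** ?H"
    by (simp add: C'_def)
  note form = kalman_gain_information_form[OF C N N', of ?H, folded C' K_def]
  show ?thesis
    by (simp add: matrix_vector_right_distrib matrix_vector_mul_assoc form HN)
qed

subsection \<open>Covariance of the linearized error\<close>

context attitude_measurements
begin

text \<open>Every summand of the quadratic form is nonnegative. If the first one vanished, both
  cross products with \<open>x\<close> would be zero and \<open>x\<close> would lie in the kernel of
  \<open>information 1\<close>.\<close>

lemma information_positive_definite:
  assumes "invertible (information 1)" "n \<ge> 1" "x \<noteq> 0"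
  shows "x \<bullet> (information n *v x) > 0"
proof -
  let ?q = "\<lambda>k. \<Sum>i\<in>{0, 1}. (norm (cross3 (d k i) x))\<^sup>2 / (\<sigma> k i)\<^sup>2"
  have nonneg: "?q k \<ge> 0" for k
    by (intro sum_nonneg) simp
  have "?q 1 \<noteq> 0"
  proof
    assume "?q 1 = 0"
    then have "(norm (cross3 (d 1 i) x))\<^sup>2 / (\<sigma> 1 i)\<^sup>2 = 0" if "i \<in> {0, 1}" for i
      using that by (subst (asm) sum_nonneg_eq_0_iff) auto
    then have "cross3 (d 1 i) x = 0" if "i \<in> {0, 1}" for i
      using \<sigma>_pos[of 1 i] that by fastforce
    then have "information 1 *v x = 0"
      unfolding information_vector_mult by simp
    then have "(matrix_inv (information 1) ** information 1) *v x = 0"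
      by (simp flip: matrix_vector_mul_assoc)
    then show False
      using assms(1,3) by (simp add: matrix_inv_left)
  qed
  then have "0 < ?q 1"
    using nonneg[of 1] by linarith
  also have "?q 1 \<le> (\<Sum>k=1..n. ?q k)"
    using nonneg assms(2) by (intro member_le_sum) auto
  finally show ?thesis
    by (simp only: information_quadratic_form)
qed

text \<open>The right-hand side of the normal equations. The gradient of the log-likelihood in the
  direction of the rotation vector is the same expression with the noise rotated by
  \<open>R (t k)\<close>.\<close>

definition score :: "nat \<Rightarrow> 'w \<Rightarrow> real^3" where
  "score k w = (\<Sum>i\<in>{0, 1}. (1 / (\<sigma> k i)\<^sup>2) *\<^sub>R (transpose (skew (d k i)) *v V k i w))"

text \<open>Completing the square around the solution \<open>y\<close> of the normal equations gives
  \<open>?f (y + e) = ?f y + e \<bullet> (information 1 *v e)\<close>; by positive definiteness a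
  minimizer must be \<open>y\<close>.\<close>

lemma maximum_likelihood_error:
  assumes "invertible (information 1)"
    and min: "is_arg_min
      (\<lambda>x. (norm (cross3 x (d 1 0) + V 1 0 w))\<^sup>2 / (\<sigma> 1 0)\<^sup>2
         + (norm (cross3 x (d 1 1) + V 1 1 w))\<^sup>2 / (\<sigma> 1 1)\<^sup>2) (\<lambda>_. True) z"
  shows "information 1 *v z = score 1 w"
proof -
  let ?f = "\<lambda>x. \<Sum>i\<in>{0, 1}. (norm (cross3 x (d 1 i) + V 1 i w))\<^sup>2 / (\<sigma> 1 i)\<^sup>2"
  define y where "y = matrix_inv (information 1) *v score 1 w"
  have y: "information 1 *v y = score 1 w"
    using assms(1) by (simp add: y_def matrix_vector_mul_assoc matrix_inv_right)
  have "?f (y + e) = ?f y + e \<bullet> (information 1 *v e)" for e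
  proof -
    have *: "(norm (cross3 (y + e) (d 1 i) + V 1 i w))\<^sup>2 / (\<sigma> 1 i)\<^sup>2 =
        (norm (cross3 y (d 1 i) + V 1 i w))\<^sup>2 / (\<sigma> 1 i)\<^sup>2
        + 2 * (e \<bullet> ((1 / (\<sigma> 1 i)\<^sup>2) *\<^sub>R (transpose (skew (d 1 i)) *v cross3 (d 1 i) y)
             - (1 / (\<sigma> 1 i)\<^sup>2) *\<^sub>R (transpose (skew (d 1 i)) *v V 1 i w)))
        + (norm (cross3 (d 1 i) e))\<^sup>2 / (\<sigma> 1 i)\<^sup>2" for i
    proof -
      have sq: "(norm (v - a - b))\<^sup>2 = (norm (v - a))\<^sup>2 + 2 * (b \<bullet> a - b \<bullet> v) + (norm b)\<^sup>2"
        for v a b :: "real^3"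
        unfolding power2_norm_eq_inner by (simp add: inner_diff inner_commute)
      \<comment> \<open>The unknown stands on the left of the cross product in the least squares
        problem but on the right in \<open>skew\<close>, hence the minus signs.\<close>
      have eq: "cross3 (y + e) (d 1 i) + V 1 i w = V 1 i w - cross3 (d 1 i) y - cross3 (d 1 i) e"
        "cross3 y (d 1 i) + V 1 i w = V 1 i w - cross3 (d 1 i) y"
        using cross_skew[of "y + e" "d 1 i"] cross_skew[of y "d 1 i"]
        by (simp_all add: cross_add_right)
      show ?thesis
        unfolding eq sq
        by (simp add: inner_diff_right inner_transpose_vector_mult skew_vector_mult
            add_divide_distrib diff_divide_distrib)
    qed
    have "?f (y + e) = ?f y + 2 * (e \<bullet> (information 1 *v y - score 1 w))
        + e \<bullet> (information 1 *v e)"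
      unfolding information_quadratic_form * sum.distrib
      by (simp add: information_vector_mult score_def inner_add_right inner_diff_right)
    then show ?thesis
      unfolding y by simp
  qed
  from this[of "z - y"] have "(z - y) \<bullet> (information 1 *v (z - y)) = ?f z - ?f y"
    by simp
  also have "\<dots> \<le> 0"
    using min by (auto simp: is_arg_min_def not_less)
  finally have "z = y"
    using information_positive_definite[OF assms(1), of 1 "z - y"] by force
  then show ?thesis
    using y by simp
qed

lemma second_moment_linear_combination:
  fixes L :: "nat \<times> nat \<Rightarrow> real^3^'n"
  assumes "finite I" "I \<subseteq> {1..} \<times> {0, 1}"
  shows "second_moment M (\<lambda>w. \<Sum>(k, i)\<in>I. L (k, i) *v V k i w) =
    (\<Sum>(k, i)\<in>I. (\<sigma> k i)\<^sup>2 *\<^sub>R (L (k, i) ** transpose (L (k, i))))"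
proof -
  define W where "W p = V (fst p) (snd p)" for p
  define s where "s p = (\<sigma> (fst p) (snd p))\<^sup>2" for p
  have W: "integrable M (\<lambda>w. W p w $ a)" "(\<integral>w. W p w $ a \<partial>M) = 0"
    "integrable M (\<lambda>w. W p w $ a * W p w $ b)"
    "(\<integral>w. W p w $ a * W p w $ b \<partial>M) = (if a = b then s p else 0)" if "p \<in> I" for p a b
  proof -
    have p: "fst p \<ge> 1" "snd p \<in> {0, 1}"
      using that assms(2) by auto
    show "integrable M (\<lambda>w. W p w $ a)" "(\<integral>w. W p w $ a \<partial>M) = 0"
      "integrable M (\<lambda>w. W p w $ a * W p w $ b)"
      "(\<integral>w. W p w $ a * W p w $ b \<partial>M) = (if a = b then s p else 0)"
      unfolding W_def s_def using \<sigma>_pos[OF p] V_gaussian[OF p]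
      by (rule integrable_gaussian_component integral_gaussian_component
          integrable_gaussian_component_mult integral_gaussian_component_mult)+
  qed
  have cov: "integrable M (\<lambda>w. W p w $ a * W q w $ b)"
    "(\<integral>w. W p w $ a * W q w $ b \<partial>M) = (if p = q \<and> a = b then s p else 0)"
    if "p \<in> I" "q \<in> I" for p q a b
  proof -
    have "integrable M (\<lambda>w. W p w $ a * W q w $ b) \<and> (\<integral>w. W p w $ a * W q w $ b \<partial>M) = 0"
      if "p \<noteq> q"
    proof -
      have "indep_vars (\<lambda>_. borel) W {p, q}"
        using indep_vars_subset[OF V_indep, of "{p, q}"] \<open>p \<in> I\<close> \<open>q \<in> I\<close> assms(2)
        by (auto simp: W_def[abs_def] case_prod_unfold)
      \<comment> \<open>One family that reads coordinate \<open>a\<close> of the first vector and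
        \<open>b\<close> of the second, so that the expectation of their product factors into two
        zero means.\<close>
      then have indep: "indep_vars (\<lambda>_. borel) (\<lambda>r w. W r w $ (if r = p then a else b)) {p, q}"
        by (rule indep_vars_compose2) simp
      have int: "integrable M (\<lambda>w. W r w $ (if r = p then a else b))" if "r \<in> {p, q}" for r
        using that \<open>p \<in> I\<close> \<open>q \<in> I\<close> W(1) by blast
      show ?thesis
        using indep_vars_integrable[OF _ indep int] indep_vars_lebesgue_integral[OF _ indep int]
          \<open>p \<noteq> q\<close> W(2)[OF \<open>p \<in> I\<close>] by simp
    qed
    then show "integrable M (\<lambda>w. W p w $ a * W q w $ b)"
      "(\<integral>w. W p w $ a * W q w $ b \<partial>M) = (if p = q \<and> a = b then s p else 0)"
      using W(3,4)[OF \<open>p \<in> I\<close>] by (cases "p = q"; simp)+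
  qed
  have component: "(\<Sum>p\<in>I. L p *v W p w) $ j = (\<Sum>p\<in>I. \<Sum>a\<in>UNIV. L p $ j $ a * W p w $ a)" for w j
    by (simp add: matrix_vector_mult_def)
  have "(\<integral>w. (\<Sum>p\<in>I. L p *v W p w) $ j * (\<Sum>p\<in>I. L p *v W p w) $ l \<partial>M) =
      (\<Sum>p\<in>I. s p * (\<Sum>a\<in>UNIV. L p $ j $ a * L p $ l $ a))" for j l
  proof -
    have "(\<Sum>p\<in>I. L p *v W p w) $ j * (\<Sum>p\<in>I. L p *v W p w) $ l =
        (\<Sum>p\<in>I. \<Sum>q\<in>I. \<Sum>a\<in>UNIV. \<Sum>b\<in>UNIV. (L p $ j $ a * L q $ l $ b) * (W p w $ a * W q w $ b))" for w
      unfolding component by (simp add: sum_product mult.commute mult.left_commute)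
    then have "(\<integral>w. (\<Sum>p\<in>I. L p *v W p w) $ j * (\<Sum>p\<in>I. L p *v W p w) $ l \<partial>M) =
        (\<Sum>p\<in>I. \<Sum>q\<in>I. \<Sum>a\<in>UNIV. \<Sum>b\<in>UNIV. (L p $ j $ a * L q $ l $ b) *
          (if p = q \<and> a = b then s p else 0))"
      by (simp add: cov Bochner_Integration.integral_sum Bochner_Integration.integrable_sum)
    also have "\<dots> = (\<Sum>p\<in>I. \<Sum>q\<in>I. if p = q then s p * (\<Sum>a\<in>UNIV. L p $ j $ a * L p $ l $ a) else 0)"
      by (intro sum.cong refl) (auto simp: if_distrib sum_distrib_left mult_ac cong: if_cong)
    finally show ?thesis
      using assms(1) by simp
  qed
  then have "second_moment M (\<lambda>w. \<Sum>p\<in>I. L p *v W p w) = (\<Sum>p\<in>I. s p *\<^sub>R (L p ** transpose (L p)))"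
    by (simp add: second_moment_def vec_eq_iff matrix_matrix_mult_def transpose_def)
  then show ?thesis
    by (simp add: W_def s_def case_prod_unfold)
qed

text \<open>The error is \<open>B\<close> times the accumulated score, where \<open>B\<close> is the
  inverse information. The score has second moment \<open>information n\<close>, so the result is
  \<open>B ** information n ** B\<close>, which is \<open>B\<close>.\<close>

lemma second_moment_information_inverse:
  assumes "invertible (information n)"
    and X: "\<And>w. w \<in> space M \<Longrightarrow> information n *v X w = (\<Sum>k=1..n. score k w)"
  shows "second_moment M X = matrix_inv (information n)"
proof -
  let ?I = "{1..n} \<times> {0, 1 :: nat}"
  define B where "B = matrix_inv (information n)"
  have B: "B ** information n = mat 1" "information n ** B = mat 1"
    using assms(1) by (simp_all add: B_def matrix_inv_left matrix_inv_right)
  have sym: "transpose B = B"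
  proof -
    have "transpose B = transpose B ** (information n ** B)"
      by (simp add: B)
    also have "\<dots> = transpose (information n ** B) ** B"
      by (simp add: matrix_transpose_mul transpose_information matrix_mul_assoc)
    finally show ?thesis
      by (simp add: B)
  qed
  define L where "L = (\<lambda>(k, i). B ** ((1 / (\<sigma> k i)\<^sup>2) *\<^sub>R transpose (skew (d k i))))"
  have "X w = (\<Sum>(k, i)\<in>?I. L (k, i) *v V k i w)" if "w \<in> space M" for w
  proof -
    have "X w = B *v (information n *v X w)"
      by (simp add: matrix_vector_mul_assoc B)
    also have "\<dots> = (\<Sum>k=1..n. \<Sum>i\<in>{0, 1}. L (k, i) *v V k i w)"
      unfolding X[OF that] score_def L_def
      by (simp add: linear_sum[OF matrix_vector_mul_linear] matrix_vector_right_distrib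
          flip: matrix_vector_mul_assoc scaleR_matrix_vector_assoc)
    finally show ?thesis
      by (simp only: sum.cartesian_product)
  qed
  then have "second_moment M X = second_moment M (\<lambda>w. \<Sum>(k, i)\<in>?I. L (k, i) *v V k i w)"
    unfolding second_moment_def by (simp cong: Bochner_Integration.integral_cong)
  also have "\<dots> = (\<Sum>(k, i)\<in>?I. (\<sigma> k i)\<^sup>2 *\<^sub>R (L (k, i) ** transpose (L (k, i))))"
    by (rule second_moment_linear_combination) auto
  also have "\<dots> = (\<Sum>(k, i)\<in>?I. B ** ((1 / (\<sigma> k i)\<^sup>2) *\<^sub>R (transpose (skew (d k i)) ** skew (d k i))) ** B)"
  proof (intro sum.cong refl, clarify)
    fix k i assume "k \<in> {1..n}" "i \<in> {0, 1 :: nat}"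
    then have "\<sigma> k i > 0"
      by (intro \<sigma>_pos) auto
    \<comment> \<open>One variance comes from the noise; the fourth power comes from the two weights
      in \<open>L\<close>.\<close>
    then have "(\<sigma> k i)\<^sup>2 / \<sigma> k i ^ 4 = 1 / (\<sigma> k i)\<^sup>2"
      by (simp add: power2_eq_square power4_eq_xxxx)
    then show "(\<sigma> k i)\<^sup>2 *\<^sub>R (L (k, i) ** transpose (L (k, i))) =
        B ** ((1 / (\<sigma> k i)\<^sup>2) *\<^sub>R (transpose (skew (d k i)) ** skew (d k i))) ** B"
      by (simp add: L_def matrix_transpose_mul transpose_scalar sym matrix_mult.scaleR_left
          matrix_mult.scaleR_right matrix_mul_assoc)
  qed
  also have "\<dots> = B ** information n ** B"
    by (simp add: information_def sum.cartesian_product matrix_mult.sum_left matrix_mult.sum_right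
        case_prod_unfold del: sum.insert)
  also have "\<dots> = B"
    by (simp add: B)
  finally show ?thesis
    by (simp add: B_def)
qed

lemma iekf_error_score:
  assumes "invertible (information 1)" "iekf M om t d \<sigma> V R Rhat xi K P" "n \<ge> 1" "w \<in> space M"
  shows "information n *v xi n (t n) w = (\<Sum>k=1..n. score k w)"
  using assms(3,4)
\<comment> \<open>The gain contains a covariance, an integral over all outcomes, so the induction
  hypothesis is needed beyond the given \<open>w\<close>.\<close>
proof (induction n arbitrary: w rule: nat_induct_at_least)
  case base
  then have "information 1 *v xi 1 (t 1) w = score 1 w"
    using assms(1,2) unfolding iekf_def iekf_linearized_error_def
    by (intro maximum_likelihood_error) auto
  then show ?case
    by simp
next
  case (Suc n)
  have err: "iekf_linearized_error M t d \<sigma> V K xi"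
    and gain: "K (Suc n) = kalman_gain (second_moment M (xi n (t (Suc n))))
      (stack (skew (d (Suc n) 0)) (skew (d (Suc n) 1)))
      (block_diag ((\<sigma> (Suc n) 0)\<^sup>2 *\<^sub>R mat 1) ((\<sigma> (Suc n) 1)\<^sup>2 *\<^sub>R mat 1))"
    using assms(2) Suc.hyps unfolding iekf_def by (auto dest: spec[of _ "Suc n"])
  \<comment> \<open>Zero derivative on the closed interval between the measurement times gives
    equality of the endpoint values; the interval may reduce to a point.\<close>
  have propagate: "xi n (t (Suc n)) w' = xi n (t n) w'" if w': "w' \<in> space M" for w'
  proof -
    have "((\<lambda>s. xi n s w') has_vector_derivative 0) (at s within {t n..t (n + 1)})"
      if "s \<in> {t n..t (n + 1)}" for s
      using err w' Suc.hyps that unfolding iekf_linearized_error_def by blast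
    then obtain c where "\<And>s. s \<in> {t n..t (n + 1)} \<Longrightarrow> xi n s w' = c"
      using has_vector_derivative_zero_constant[of "{t n..t (n + 1)}" "\<lambda>s. xi n s w'"] by auto
    then show ?thesis
      using t_mono[OF Suc.hyps] by simp
  qed
  have pos: "x \<bullet> (information n *v x) > 0" if "x \<noteq> 0" for x
    using information_positive_definite assms(1) Suc.hyps that by blast
  \<comment> \<open>This identifies the prior covariance inside the gain, which is what the
    information form of the update requires.\<close>
  have "second_moment M (xi n (t (Suc n))) = matrix_inv (information n)"
    using positive_definite_invertible[OF pos] Suc.IH
    by (intro second_moment_information_inverse) (simp_all add: propagate)
  note gain = gain[unfolded this]
  have step: "information (Suc n) = information n
      + (1 / (\<sigma> (Suc n) 0)\<^sup>2) *\<^sub>R (transpose (skew (d (Suc n) 0)) ** skew (d (Suc n) 0))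
      + (1 / (\<sigma> (Suc n) 1)\<^sup>2) *\<^sub>R (transpose (skew (d (Suc n) 1)) ** skew (d (Suc n) 1))"
    by (simp add: information_def add.assoc)
  have "xi (Suc n) (t (Suc n)) w =
      (mat 1 - K (Suc n) ** stack (skew (d (Suc n) 0)) (skew (d (Suc n) 1))) *v xi n (t (Suc n)) w
        + K (Suc n) *v stack (V (Suc n) 0 w) (V (Suc n) 1 w)"
    using err Suc.prems Suc.hyps unfolding iekf_linearized_error_def
    by (auto dest!: bspec[of _ _ w] spec[of _ "Suc n"])
  then have "information (Suc n) *v xi (Suc n) (t (Suc n)) w =
      information n *v xi n (t (Suc n)) w + score (Suc n) w"
    using kalman_update_information_form[OF pos, of "(\<sigma> (Suc n) 0)\<^sup>2" "(\<sigma> (Suc n) 1)\<^sup>2"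
        "skew (d (Suc n) 0)" "skew (d (Suc n) 1)"] \<sigma>_pos[of "Suc n" 0] \<sigma>_pos[of "Suc n" 1]
    unfolding gain step by (simp add: score_def)
  then show ?case
    using Suc.IH[OF Suc.prems] Suc.prems by (simp add: propagate)
qed

end

text \<open>Invertibility is asserted along with the formulas because \<open>matrix_inv\<close> is
  total, and unique existence of the Fisher information keeps the last clause from holding
  vacuously.\<close>

theorem proposition4:
  fixes M :: "'w measure"
    and om :: "real \<Rightarrow> real^3"
    and t :: "nat \<Rightarrow> real"
    and R :: "real \<Rightarrow> real^3^3"
    and d :: "nat \<Rightarrow> nat \<Rightarrow> real^3"
    and \<sigma> :: "nat \<Rightarrow> nat \<Rightarrow> real"
    and V :: "nat \<Rightarrow> nat \<Rightarrow> 'w \<Rightarrow> real^3"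
    and Rhat :: "nat \<Rightarrow> real \<Rightarrow> 'w \<Rightarrow> real^3^3"
    and xi :: "nat \<Rightarrow> real \<Rightarrow> 'w \<Rightarrow> real^3"
    and K :: "nat \<Rightarrow> real^(3+3)^3"
    and P :: "nat \<Rightarrow> real^3^3"
    and H :: "nat \<Rightarrow> nat \<Rightarrow> real^3^3"
    and n :: nat
  assumes "prob_space M"
    and "\<And>k. k \<ge> 1 \<Longrightarrow> t k \<le> t (k + 1)"
    and "attitude_trajectory om {t 1..} R"
    and "\<And>k i. k \<ge> 1 \<Longrightarrow> i \<in> {0, 1} \<Longrightarrow> \<sigma> k i > 0"
    and "\<And>k i. k \<ge> 1 \<Longrightarrow> i \<in> {0, 1} \<Longrightarrow> gaussian_vector M (V k i) 0 ((\<sigma> k i)\<^sup>2 *\<^sub>R mat 1)"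
    and "prob_space.indep_vars M (\<lambda>_. borel) (\<lambda>(k, i). V k i) ({1..} \<times> {0, 1})"
    and "\<And>k i. H k i = skew (d k i)"
    and "invertible ((1 / (\<sigma> 1 0)\<^sup>2) *\<^sub>R (transpose (H 1 0) ** H 1 0)
                   + (1 / (\<sigma> 1 1)\<^sup>2) *\<^sub>R (transpose (H 1 1) ** H 1 1))"
    and "iekf M om t d \<sigma> V R Rhat xi K P"
    and "n \<ge> 1"
  shows "invertible ((\<Sum>k=1..n. (1 / (\<sigma> k 0)\<^sup>2) *\<^sub>R (transpose (H k 0) ** H k 0))
                   + (\<Sum>k=1..n. (1 / (\<sigma> k 1)\<^sup>2) *\<^sub>R (transpose (H k 1) ** H k 1)))
       \<and> P n = matrix_inv
                 ((\<Sum>k=1..n. (1 / (\<sigma> k 0)\<^sup>2) *\<^sub>R (transpose (H k 0) ** H k 0))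
                + (\<Sum>k=1..n. (1 / (\<sigma> k 1)\<^sup>2) *\<^sub>R (transpose (H k 1) ** H k 1)))
       \<and> (\<exists>!J. is_fisher_information M om t d V R n J)
       \<and> (\<forall>J. is_fisher_information M om t d V R n J \<longrightarrow> invertible J \<and> P n = matrix_inv J)"
proof -
  interpret prob_space M
    by fact
  interpret attitude_measurements M om t d \<sigma> V R
    using assms(2-6) by unfold_locales
  let ?C = "(\<Sum>k=1..n. (1 / (\<sigma> k 0)\<^sup>2) *\<^sub>R (transpose (H k 0) ** H k 0))
    + (\<Sum>k=1..n. (1 / (\<sigma> k 1)\<^sup>2) *\<^sub>R (transpose (H k 1) ** H k 1))"
  have C: "information n = ?C"
    by (simp add: information_def assms(7) sum.distrib)
  have init: "invertible (information 1)"
    using assms(8) by (simp add: information_def assms(7))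
  have inv: "invertible (information n)"
    using information_positive_definite[OF init assms(10)] by (rule positive_definite_invertible)
  have "P n = second_moment M (xi n (t n))"
    using assms(9,10) by (simp add: iekf_def)
  also have "\<dots> = matrix_inv (information n)"
    using inv iekf_error_score[OF init assms(9,10)] by (rule second_moment_information_inverse)
  finally show ?thesis
    using inv unfolding C[symmetric] is_fisher_information_iff[OF assms(10)] by simp
qed

end
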